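(* Let $0<\alpha<1$, $0<\beta<\infty$, $u\in H(\mathbb{D})$, $\varphi\in S(\mathbb{D})$, and suppose $uC_\varphi:\mathcal{B}^\alpha\to\mathcal{Z}_\beta$ is bounded. Then $$\|uC_\varphi\|_{e,\mathcal{B}^\alpha\to\mathcal{Z}_\beta}\asymp\max\Big\{\limsup_{n\to\infty}(n+1)^\alpha\|(2u'\varphi'+u\varphi'')\varphi^n\|_{\nu_\beta},\ \limsup_{n\to\infty}(n+1)^{\alpha+1}\|u(\varphi')^2\varphi^n\|_{\nu_\beta}\Big\}.$$
   Context: $\mathbb{D}$ is the open unit disk, $H(\mathbb{D})$ the holomorphic functions on $\mathbb{D}$, $S(\mathbb{D})$ the holomorphic self-maps of $\mathbb{D}$; $uC_\varphi f(z)=u(z)f(\varphi(z))$, and $\varphi^n$ is the $n$-th power of $\varphi$. $\mathcal{B}^\alpha$ is the space of $f\in H(\mathbb{D})$ with $\sup_z(1-|z|^2)^\alpha|f'(z)|<\infty$, normed by $|f(0)|+\sup_z(1-|z|^2)^\alpha|f'(z)|$. $\mathcal{Z}_\beta$ is the space of $f\in H(\mathbb{D})$ with $\sup_z(1-|z|^2)^\beta|f''(z)|<\infty$, normed by $|f(0)|+|f'(0)|+\sup_z(1-|z|^2)^\beta|f''(z)|$. For $g\in H(\mathbb{D})$, $\|g\|_{\nu_\beta}=\sup_z(1-|z|^2)^\beta|g(z)|$. The essential norm of a bounded operator $T:X\to Y$ is $\inf\{\|T-K\|:K:X\to Y\text{ compact}\}$. $A\asymp B$ means $B/C\le A\le CB$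 for a positive constant $C$ independent of $u,\varphi$. *)

theory Defs
  imports "HOL-Analysis.Analysis"
begin

abbreviation udisk :: "complex set" where "udisk \<equiv> ball 0 1"

definition bloch_space :: "real \<Rightarrow> (complex \<Rightarrow> complex) set" where
  "bloch_space \<alpha> = {f. f holomorphic_on udisk \<and>
      bdd_above ((\<lambda>z. (1 - (cmod z)\<^sup>2) powr \<alpha> * cmod (deriv f z)) ` udisk)}"

definition bloch_norm :: "real \<Rightarrow> (complex \<Rightarrow> complex) \<Rightarrow> real" where
  "bloch_norm \<alpha> f = cmod (f 0) +
      (SUP z\<in>udisk. (1 - (cmod z)\<^sup>2) powr \<alpha> * cmod (deriv f z))"

definition zyg_space :: "real \<Rightarrow> (complex \<Rightarrow> complex) set" where
  "zyg_space \<beta> = {f. f holomorphic_on udisk \<and>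
      bdd_above ((\<lambda>z. (1 - (cmod z)\<^sup>2) powr \<beta> * cmod (deriv (deriv f) z)) ` udisk)}"

definition zyg_norm :: "real \<Rightarrow> (complex \<Rightarrow> complex) \<Rightarrow> real" where
  "zyg_norm \<beta> f = cmod (f 0) + cmod (deriv f 0) +
      (SUP z\<in>udisk. (1 - (cmod z)\<^sup>2) powr \<beta> * cmod (deriv (deriv f) z))"

text \<open>Weighted sup norm (possibly infinite, hence extended real).\<close>
definition nu_norm :: "real \<Rightarrow> (complex \<Rightarrow> complex) \<Rightarrow> ereal" where
  "nu_norm \<beta> g = (SUP z\<in>udisk. ereal ((1 - (cmod z)\<^sup>2) powr \<beta> * cmod (g z)))"

definition wcomp :: "(complex \<Rightarrow> complex) \<Rightarrow> (complex \<Rightarrow> complex) \<Rightarrow>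
    (complex \<Rightarrow> complex) \<Rightarrow> (complex \<Rightarrow> complex)" where
  "wcomp u \<phi> f = (\<lambda>z. u z * f (\<phi> z))"

definition self_maps :: "(complex \<Rightarrow> complex) set" where
  "self_maps = {\<phi>. \<phi> holomorphic_on udisk \<and> \<phi> ` udisk \<subseteq> udisk}"

definition linear_op_on :: "(complex \<Rightarrow> complex) set \<Rightarrow> (complex \<Rightarrow> complex) set \<Rightarrow> ((complex \<Rightarrow> complex) \<Rightarrow> (complex \<Rightarrow> complex)) \<Rightarrow> bool" where
  "linear_op_on X Y T \<longleftrightarrow> (\<forall>f\<in>X. T f \<in> Y) \<and>
     (\<forall>f\<in>X. \<forall>g\<in>X. \<forall>a b::complex. \<forall>z\<in>udisk.
        T (\<lambda>w. a * f w + b * g w) z = a * T f z + b * T g z)"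

definition bdd_wop :: "(complex \<Rightarrow> complex) set \<Rightarrow> ((complex \<Rightarrow> complex) \<Rightarrow> real) \<Rightarrow> (complex \<Rightarrow> complex) set \<Rightarrow> ((complex \<Rightarrow> complex) \<Rightarrow> real) \<Rightarrow> ((complex \<Rightarrow> complex) \<Rightarrow> (complex \<Rightarrow> complex)) \<Rightarrow> bool" where
  "bdd_wop X nX Y nY T \<longleftrightarrow> linear_op_on X Y T \<and>
     bdd_above ((\<lambda>f. nY (T f)) ` {f\<in>X. nX f \<le> (1::real)})"

definition wop_norm :: "(complex \<Rightarrow> complex) set \<Rightarrow> ((complex \<Rightarrow> complex) \<Rightarrow> real) \<Rightarrow> ((complex \<Rightarrow> complex) \<Rightarrow> real) \<Rightarrow> ((complex \<Rightarrow> complex) \<Rightarrow> (complex \<Rightarrow> complex)) \<Rightarrow> real" where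
  "wop_norm X nX nY T = (SUP f\<in>{f\<in>X. nX f \<le> (1::real)}. nY (T f) :: real)"

definition cpt_wop :: "(complex \<Rightarrow> complex) set \<Rightarrow> ((complex \<Rightarrow> complex) \<Rightarrow> real) \<Rightarrow> (complex \<Rightarrow> complex) set \<Rightarrow> ((complex \<Rightarrow> complex) \<Rightarrow> real) \<Rightarrow> ((complex \<Rightarrow> complex) \<Rightarrow> (complex \<Rightarrow> complex)) \<Rightarrow> bool" where
  "cpt_wop X nX Y nY K \<longleftrightarrow> linear_op_on X Y K \<and>
     (\<forall>s. (\<forall>n. s n \<in> X \<and> nX (s n) \<le> (1::real)) \<longrightarrow>
        (\<exists>(r::nat \<Rightarrow> nat) g. strict_mono r \<and> g \<in> Y \<and>
           (\<lambda>n. nY (\<lambda>z. K (s (r n)) z - g z)) \<longlonglongrightarrow> (0::real)))"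

definition ess_norm :: "(complex \<Rightarrow> complex) set \<Rightarrow> ((complex \<Rightarrow> complex) \<Rightarrow> real) \<Rightarrow> (complex \<Rightarrow> complex) set \<Rightarrow> ((complex \<Rightarrow> complex) \<Rightarrow> real) \<Rightarrow> ((complex \<Rightarrow> complex) \<Rightarrow> (complex \<Rightarrow> complex)) \<Rightarrow> real" where
  "ess_norm X nX Y nY T =
     Inf ((\<lambda>K. wop_norm X nX nY (\<lambda>f z. T f z - K f z)) ` {K. cpt_wop X nX Y nY K})"

end

(* The second derivative of u f(phi) is u'' f(phi) + A f'(phi) + B f''(phi) with A = 2 u' phi' + u phi''
   and B = u phi'^2. For the lower bound, the monomials n^(alpha-1) z^n are bounded in the Bloch type
   space and tend to 0 locally uniformly, so the contribution of any compact operator is asymptotically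
   negligible along them; comparing the exponents n and 2n separates A from B. For the upper bound,
   uC_phi is approximated by the compact operators f -> u f(r phi): for alpha < 1 the difference
   f - f(r .) tends to 0 uniformly on the disc, hence its derivatives are small where |phi| stays away
   from 1, and where |phi| is close to 1 the weighted sizes of A and B are controlled by
   the power norms with n about 1 / (1 - |phi|). *)

theory Submission
  imports Defs "HOL-Complex_Analysis.Complex_Analysis"
begin

text \<open>No term with u'' survives in the equivalence. For alpha < 1 the radial majorant (1 - s)
  powr (- alpha) of |f'| is integrable up to s = 1, so the unit ball of the Bloch type space is
  uniformly bounded and f(z) - f(r z) is small on the whole disc; the weighted u'' then only has to
  be bounded. In the lower bound the obstacle is that K is arbitrary: all that is known is that K
  converges along some subsequence of the monomials, and the limit is not identified. Differences of
  two monomials cancel this limit, and sending one of the two exponents to infinity at a fixed point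
  of the disc gives back a single monomial, at the price of a factor 2. Suprema and infima of reals
  carry information only for bounded nonempty sets, so boundedness has to be established before
  operator norms and the essential norm can be used. The constants are absolute: the lower estimate
  costs 132 = 4 * 33 and the upper one 408 = 34 * 12, whatever alpha and beta are.\<close>

section \<open>Weights, derivatives and a Cauchy estimate on the disc\<close>

abbreviation weight :: "real \<Rightarrow> complex \<Rightarrow> real" where
  "weight \<beta> z \<equiv> (1 - (cmod z)\<^sup>2) powr \<beta>"

lemma weight_le_1: "0 \<le> \<beta> \<Longrightarrow> z \<in> udisk \<Longrightarrow> weight \<beta> z \<le> 1"
  by (rule powr_le1) (auto simp: abs_square_le_1)

lemma weight_pos: "z \<in> udisk \<Longrightarrow> 0 < weight \<beta> z"
  using power_strict_mono[of "cmod z" 1 2] by simp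

text \<open>Functions are total, but only their values on \<open>udisk\<close> are controlled. Since
  the disc is open, \<open>deriv\<close> at its points does not see the other values.\<close>

lemma deriv_cong_udisk:
  assumes "\<And>w. w \<in> udisk \<Longrightarrow> f w = g w" "z \<in> udisk"
  shows "deriv f z = deriv g z"
proof (rule deriv_cong_ev)
  have "\<forall>\<^sub>F w in nhds z. w \<in> udisk"
    using assms(2) by (intro eventually_nhds_in_open) auto
  then show "\<forall>\<^sub>F w in nhds z. f w = g w"
    by eventually_elim (rule assms(1))
qed simp

lemma deriv_lincomb:
  assumes "f holomorphic_on udisk" "g holomorphic_on udisk" "z \<in> udisk"
  shows "deriv (\<lambda>w. a * f w + b * g w) z = a * deriv f z + b * deriv g z"
  by (rule DERIV_imp_deriv)
     (auto intro!: derivative_eq_intros holomorphic_derivI[OF assms(1) open_ball assms(3)]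
        holomorphic_derivI[OF assms(2) open_ball assms(3)])

lemma deriv2_lincomb:
  assumes "f holomorphic_on udisk" "g holomorphic_on udisk" "z \<in> udisk"
  shows "deriv (deriv (\<lambda>w. a * f w + b * g w)) z = a * deriv (deriv f) z + b * deriv (deriv g) z"
proof -
  have "deriv (deriv (\<lambda>w. a * f w + b * g w)) z = deriv (\<lambda>w. a * deriv f w + b * deriv g w) z"
    using assms by (intro deriv_cong_udisk deriv_lincomb)
  also have "\<dots> = a * deriv (deriv f) z + b * deriv (deriv g) z"
    using assms by (intro deriv_lincomb holomorphic_deriv) auto
  finally show ?thesis .
qed

lemma norm_deriv_le_Cauchy:
  assumes "f holomorphic_on udisk" "0 < d" "cmod z + d < 1"
    and "\<And>x. cmod (z - x) = d \<Longrightarrow> cmod (f x) \<le> B"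
  shows "cmod (deriv f z) \<le> B / d"
proof -
  have sub: "cball z d \<subseteq> udisk"
  proof
    fix x assume "x \<in> cball z d"
    then have "cmod (x - z) \<le> d" by (simp add: dist_norm norm_minus_commute)
    then show "x \<in> udisk"
      using assms(3) norm_triangle_sub[of x z] by simp
  qed
  have "cmod ((deriv ^^ 1) f z) \<le> fact 1 * B / d ^ 1"
  proof (rule Cauchy_inequality)
    show "f holomorphic_on ball z d"
      using sub ball_subset_cball by (blast intro: holomorphic_on_subset[OF assms(1)])
    show "continuous_on (cball z d) f"
      using holomorphic_on_subset[OF assms(1) sub] by (rule holomorphic_on_imp_continuous_on)
  qed (use assms in auto)
  then show ?thesis by simp
qed

section \<open>The Zygmund type and Bloch type norms\<close>

lemma zyg_norm_ge:
  assumes "F \<in> zyg_space \<beta>"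
  shows "z \<in> udisk \<Longrightarrow> weight \<beta> z * cmod (deriv (deriv F) z) \<le> zyg_norm \<beta> F"
    and "0 \<le> zyg_norm \<beta> F"
proof -
  \<comment> \<open>A real \<open>SUP\<close> is known to be an upper bound only for a bounded set;
    membership in the space supplies the boundedness.\<close>
  have bdd: "bdd_above ((\<lambda>z. weight \<beta> z * cmod (deriv (deriv F) z)) ` udisk)"
    using assms by (simp add: zyg_space_def)
  have *: "weight \<beta> z * cmod (deriv (deriv F) z)
      \<le> (SUP z\<in>udisk. weight \<beta> z * cmod (deriv (deriv F) z))" if "z \<in> udisk" for z
    using that bdd by (rule cSUP_upper)
  then show "z \<in> udisk \<Longrightarrow> weight \<beta> z * cmod (deriv (deriv F) z) \<le> zyg_norm \<beta> F"
    unfolding zyg_norm_def by (smt (verit) norm_ge_zero)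
  have "0 \<le> weight \<beta> 0 * cmod (deriv (deriv F) 0)" by simp
  with *[of 0] show "0 \<le> zyg_norm \<beta> F"
    unfolding zyg_norm_def by (smt (verit) norm_ge_zero centre_in_ball)
qed

lemma zyg_norm_le:
  assumes "\<And>z. z \<in> udisk \<Longrightarrow> weight \<beta> z * cmod (deriv (deriv F) z) \<le> b"
  shows "zyg_norm \<beta> F \<le> cmod (F 0) + cmod (deriv F 0) + b"
  unfolding zyg_norm_def by (intro add_left_mono cSUP_least) (use assms in auto)

lemma zyg_spaceI:
  assumes "F holomorphic_on udisk"
    and "\<And>z. z \<in> udisk \<Longrightarrow> weight \<beta> z * cmod (deriv (deriv F) z) \<le> b"
  shows "F \<in> zyg_space \<beta>"
  using assms by (auto simp: zyg_space_def intro!: bdd_aboveI)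

text \<open>\<open>linear_op_on\<close> yields identities on \<open>udisk\<close> only; this
  transports them into the norm.\<close>

lemma zyg_norm_cong:
  assumes "\<And>w. w \<in> udisk \<Longrightarrow> F w = G w"
  shows "zyg_norm \<beta> F = zyg_norm \<beta> G"
proof -
  have "deriv F w = deriv G w" if "w \<in> udisk" for w
    using assms that by (rule deriv_cong_udisk)
  moreover from this have "deriv (deriv F) w = deriv (deriv G) w" if "w \<in> udisk" for w
    using that by (rule deriv_cong_udisk)
  ultimately show ?thesis
    unfolding zyg_norm_def using assms[of 0] by simp
qed

text \<open>The triangle inequality in the generality needed later, where sums, differences and half
  differences all occur.\<close>

lemma zyg_lincomb:
  assumes F: "F \<in> zyg_space \<beta>" and G: "G \<in> zyg_space \<beta>"
  shows "(\<lambda>z. a * F z + b * G z) \<in> zyg_space \<beta>"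
    and "zyg_norm \<beta> (\<lambda>z. a * F z + b * G z) \<le> cmod a * zyg_norm \<beta> F + cmod b * zyg_norm \<beta> G"
proof -
  let ?H = "\<lambda>z. a * F z + b * G z"
  define sF sG where "sF = (SUP z\<in>udisk. weight \<beta> z * cmod (deriv (deriv F) z))"
    and "sG = (SUP z\<in>udisk. weight \<beta> z * cmod (deriv (deriv G) z))"
  have holo: "F holomorphic_on udisk" "G holomorphic_on udisk"
    using F G by (auto simp: zyg_space_def)
  have le: "weight \<beta> z * cmod (deriv (deriv F) z) \<le> sF"
    "weight \<beta> z * cmod (deriv (deriv G) z) \<le> sG" if "z \<in> udisk" for z
    unfolding sF_def sG_def using F G that by (auto simp: zyg_space_def intro!: cSUP_upper)
  have bound: "weight \<beta> z * cmod (deriv (deriv ?H) z) \<le> cmod a * sF + cmod b * sG"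
    if z: "z \<in> udisk" for z
  proof -
    have "weight \<beta> z * cmod (deriv (deriv ?H) z)
        \<le> weight \<beta> z * (cmod a * cmod (deriv (deriv F) z) + cmod b * cmod (deriv (deriv G) z))"
      unfolding deriv2_lincomb[OF holo z]
      by (intro mult_left_mono) (metis norm_triangle_ineq norm_mult, simp)
    also have "\<dots> = cmod a * (weight \<beta> z * cmod (deriv (deriv F) z))
        + cmod b * (weight \<beta> z * cmod (deriv (deriv G) z))"
      by (simp add: algebra_simps)
    also have "\<dots> \<le> cmod a * sF + cmod b * sG"
      using le[OF z] by (intro add_mono mult_left_mono) auto
    finally show ?thesis .
  qed
  show "?H \<in> zyg_space \<beta>"
    by (rule zyg_spaceI[OF _ bound]) (auto intro!: holomorphic_intros holo)
  have "zyg_norm \<beta> ?H \<le> cmod (?H 0) + cmod (deriv ?H 0) + (cmod a * sF + cmod b * sG)"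
    by (rule zyg_norm_le[OF bound])
  also have "cmod (?H 0) \<le> cmod a * cmod (F 0) + cmod b * cmod (G 0)"
    by (metis norm_triangle_ineq norm_mult)
  also have "cmod (deriv ?H 0) \<le> cmod a * cmod (deriv F 0) + cmod b * cmod (deriv G 0)"
    using deriv_lincomb[OF holo, of 0] by (simp, metis norm_triangle_ineq norm_mult)
  finally show "zyg_norm \<beta> ?H \<le> cmod a * zyg_norm \<beta> F + cmod b * zyg_norm \<beta> G"
    unfolding zyg_norm_def sF_def sG_def by (simp add: algebra_simps)
qed

lemma bloch_norm_ge:
  assumes "f \<in> bloch_space \<alpha>"
  shows "z \<in> udisk \<Longrightarrow> weight \<alpha> z * cmod (deriv f z) \<le> bloch_norm \<alpha> f"
proof -
  have bdd: "bdd_above ((\<lambda>z. weight \<alpha> z * cmod (deriv f z)) ` udisk)"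
    using assms by (simp add: bloch_space_def)
  then have "weight \<alpha> z * cmod (deriv f z) \<le> (SUP z\<in>udisk. weight \<alpha> z * cmod (deriv f z))"
    if "z \<in> udisk" for z
    using that by (intro cSUP_upper)
  then show "z \<in> udisk \<Longrightarrow> weight \<alpha> z * cmod (deriv f z) \<le> bloch_norm \<alpha> f"
    unfolding bloch_norm_def by (smt (verit) norm_ge_zero)
qed

lemma norm_0_le_bloch_norm:
  assumes "f \<in> bloch_space \<alpha>"
  shows "cmod (f 0) \<le> bloch_norm \<alpha> f"
proof -
  have "bdd_above ((\<lambda>z. weight \<alpha> z * cmod (deriv f z)) ` udisk)"
    using assms by (simp add: bloch_space_def)
  then have "weight \<alpha> 0 * cmod (deriv f 0) \<le> (SUP z\<in>udisk. weight \<alpha> z * cmod (deriv f z))"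
    by (intro cSUP_upper) auto
  moreover have "0 \<le> weight \<alpha> 0 * cmod (deriv f 0)" by simp
  ultimately show ?thesis
    unfolding bloch_norm_def by linarith
qed

lemma bloch_norm_le:
  assumes "\<And>z. z \<in> udisk \<Longrightarrow> weight \<alpha> z * cmod (deriv f z) \<le> b"
  shows "bloch_norm \<alpha> f \<le> cmod (f 0) + b"
  unfolding bloch_norm_def by (intro add_left_mono cSUP_least) (use assms in auto)

lemma bloch_spaceI:
  assumes "f holomorphic_on udisk"
    and "\<And>z. z \<in> udisk \<Longrightarrow> weight \<alpha> z * cmod (deriv f z) \<le> b"
  shows "f \<in> bloch_space \<alpha>"
  using assms by (auto simp: bloch_space_def intro!: bdd_aboveI)

lemma self_maps_holomorphic: "\<phi> \<in> self_maps \<Longrightarrow> \<phi> holomorphic_on udisk"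
  and self_maps_in_udisk: "\<phi> \<in> self_maps \<Longrightarrow> z \<in> udisk \<Longrightarrow> \<phi> z \<in> udisk"
  by (auto simp: self_maps_def image_subset_iff)

section \<open>Derivatives and norms of weighted compositions\<close>

lemma
  assumes u: "u holomorphic_on udisk" and \<phi>: "\<phi> \<in> self_maps" and f: "f holomorphic_on udisk"
  shows deriv_wcomp: "z \<in> udisk \<Longrightarrow>
      deriv (wcomp u \<phi> f) z = deriv u z * f (\<phi> z) + u z * deriv \<phi> z * deriv f (\<phi> z)"
    and deriv2_wcomp: "z \<in> udisk \<Longrightarrow> deriv (deriv (wcomp u \<phi> f)) z =
      deriv (deriv u) z * f (\<phi> z)
      + (2 * deriv u z * deriv \<phi> z + u z * deriv (deriv \<phi>) z) * deriv f (\<phi> z)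
      + u z * (deriv \<phi> z)\<^sup>2 * deriv (deriv f) (\<phi> z)"
proof -
  note hol\<phi> = self_maps_holomorphic[OF \<phi>]
  note in\<phi> = self_maps_in_udisk[OF \<phi>]
  have Dc: "((\<lambda>z. g (\<phi> z)) has_field_derivative deriv g (\<phi> z) * deriv \<phi> z) (at z)"
    if "g holomorphic_on udisk" "z \<in> udisk" for g z
    using holomorphic_derivI[OF that(1) open_ball in\<phi>[OF that(2)]]
      holomorphic_derivI[OF hol\<phi> open_ball that(2)] by (rule DERIV_chain2)
  have Du: "(g has_field_derivative deriv g z) (at z)"
    if "g holomorphic_on udisk" "z \<in> udisk" for g z
    using that by (intro holomorphic_derivI[of _ udisk]) auto
  have d1: "deriv (wcomp u \<phi> f) z = deriv u z * f (\<phi> z) + u z * deriv \<phi> z * deriv f (\<phi> z)"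
    if "z \<in> udisk" for z
    unfolding wcomp_def
    by (rule DERIV_imp_deriv)
       (rule derivative_eq_intros Du[OF u that] Dc[OF f that] refl | simp add: algebra_simps)+
  then show "z \<in> udisk \<Longrightarrow>
      deriv (wcomp u \<phi> f) z = deriv u z * f (\<phi> z) + u z * deriv \<phi> z * deriv f (\<phi> z)" .
  note holo' = holomorphic_deriv[OF _ open_ball]
  assume z: "z \<in> udisk"
  have "deriv (deriv (wcomp u \<phi> f)) z
      = deriv (\<lambda>z. deriv u z * f (\<phi> z) + u z * deriv \<phi> z * deriv f (\<phi> z)) z"
    using d1 z by (rule deriv_cong_udisk)
  also have "\<dots> = deriv (deriv u) z * f (\<phi> z)
      + (2 * deriv u z * deriv \<phi> z + u z * deriv (deriv \<phi>) z) * deriv f (\<phi> z)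
      + u z * (deriv \<phi> z)\<^sup>2 * deriv (deriv f) (\<phi> z)"
    by (rule DERIV_imp_deriv)
       (rule derivative_eq_intros Du[OF u z] Du[OF holo'[OF u] z] Du[OF holo'[OF hol\<phi>] z]
          Dc[OF f z] Dc[OF holo'[OF f] z] refl
        | simp add: algebra_simps power2_eq_square)+
  finally show "deriv (deriv (wcomp u \<phi> f)) z =
      deriv (deriv u) z * f (\<phi> z)
      + (2 * deriv u z * deriv \<phi> z + u z * deriv (deriv \<phi>) z) * deriv f (\<phi> z)
      + u z * (deriv \<phi> z)\<^sup>2 * deriv (deriv f) (\<phi> z)" .
qed

text \<open>The last assumption bounds the sum of the three terms instead of each one, so that they
  can be estimated differently where \<open>\<phi> z\<close> is near the boundary and where it is
  not. The assumptions at \<open>\<phi> 0\<close> serve the two point evaluations at 0 in the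
  norm.\<close>

lemma zyg_norm_wcomp_le:
  assumes u: "u holomorphic_on udisk" and \<phi>: "\<phi> \<in> self_maps" and f: "f holomorphic_on udisk"
    and d: "cmod (f (\<phi> 0)) \<le> d" "cmod (deriv f (\<phi> 0)) \<le> d"
    and b: "\<And>z. z \<in> udisk \<Longrightarrow>
      weight \<beta> z * cmod (deriv (deriv u) z) * cmod (f (\<phi> z))
      + weight \<beta> z * cmod (2 * deriv u z * deriv \<phi> z + u z * deriv (deriv \<phi>) z) * cmod (deriv f (\<phi> z))
      + weight \<beta> z * cmod (u z * (deriv \<phi> z)\<^sup>2) * cmod (deriv (deriv f) (\<phi> z)) \<le> b"
  shows "zyg_norm \<beta> (wcomp u \<phi> f)
    \<le> (cmod (u 0) + cmod (deriv u 0) + cmod (u 0) * cmod (deriv \<phi> 0)) * d + b"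
proof -
  let ?A = "\<lambda>z. 2 * deriv u z * deriv \<phi> z + u z * deriv (deriv \<phi>) z"
  let ?B = "\<lambda>z. u z * (deriv \<phi> z)\<^sup>2"
  have "zyg_norm \<beta> (wcomp u \<phi> f) \<le> cmod (wcomp u \<phi> f 0) + cmod (deriv (wcomp u \<phi> f) 0) + b"
  proof (rule zyg_norm_le)
    fix z :: complex assume z: "z \<in> udisk"
    have "cmod (deriv (deriv (wcomp u \<phi> f)) z) \<le>
      cmod (deriv (deriv u) z) * cmod (f (\<phi> z)) + cmod (?A z) * cmod (deriv f (\<phi> z))
      + cmod (?B z) * cmod (deriv (deriv f) (\<phi> z))"
      unfolding deriv2_wcomp[OF u \<phi> f z] norm_mult[symmetric]
      by (meson add_right_mono norm_triangle_ineq order_trans)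
    then have "weight \<beta> z * cmod (deriv (deriv (wcomp u \<phi> f)) z) \<le> weight \<beta> z *
      (cmod (deriv (deriv u) z) * cmod (f (\<phi> z)) + cmod (?A z) * cmod (deriv f (\<phi> z))
      + cmod (?B z) * cmod (deriv (deriv f) (\<phi> z)))"
      by (rule mult_left_mono) simp
    with b[OF z] show "weight \<beta> z * cmod (deriv (deriv (wcomp u \<phi> f)) z) \<le> b"
      by (simp add: algebra_simps)
  qed
  also have "cmod (wcomp u \<phi> f 0) \<le> cmod (u 0) * d"
    unfolding wcomp_def norm_mult using d by (intro mult_left_mono) auto
  also have "cmod (deriv (wcomp u \<phi> f) 0)
      \<le> cmod (deriv u 0) * cmod (f (\<phi> 0)) + cmod (u 0) * cmod (deriv \<phi> 0) * cmod (deriv f (\<phi> 0))"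
    using deriv_wcomp[OF u \<phi> f, of 0] by (simp add: norm_triangle_le norm_mult)
  also have "\<dots> \<le> cmod (deriv u 0) * d + cmod (u 0) * cmod (deriv \<phi> 0) * d"
    using d by (intro add_mono mult_left_mono) auto
  finally show ?thesis by (simp add: algebra_simps)
qed

section \<open>Bounded coefficients from the test functions 1, z, z^2\<close>

lemma deriv_power: "deriv (\<lambda>z::complex. z ^ n) = (\<lambda>z. of_nat n * z ^ (n - 1))"
  by (rule ext, rule DERIV_imp_deriv) (auto intro!: derivative_eq_intros)

lemma deriv2_power:
  "deriv (deriv (\<lambda>z::complex. z ^ n)) z = of_nat n * (of_nat (n - 1) * z ^ (n - 2))"
  unfolding deriv_power
  by (rule DERIV_imp_deriv) (auto intro!: derivative_eq_intros simp: numeral_2_eq_2)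

lemma power_in_bloch_space:
  assumes "0 \<le> \<alpha>"
  shows "(\<lambda>z. z ^ n) \<in> bloch_space \<alpha>"
proof (rule bloch_spaceI)
  fix z :: complex assume z: "z \<in> udisk"
  then have "cmod z ^ (n - 1) \<le> 1" by (simp add: power_le_one)
  then have "weight \<alpha> z * (real n * cmod z ^ (n - 1)) \<le> 1 * (real n * 1)"
    using weight_le_1[OF assms z] by (intro mult_mono) auto
  then show "weight \<alpha> z * cmod (deriv (\<lambda>z. z ^ n) z) \<le> real n"
    by (simp add: deriv_power norm_mult norm_power)
qed (intro holomorphic_intros)

text \<open>The images of 1, z and z^2 have the second derivatives u'', u'' phi + A and u'' phi^2 +
  2 A phi + 2 B, all of finite weighted size. This triangular system is solved successively for u'',
  A and B, using |phi| < 1.\<close>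

lemma wcomp_coefficients_bounded:
  assumes u: "u holomorphic_on udisk" and \<phi>: "\<phi> \<in> self_maps" and "0 \<le> \<alpha>"
    and maps: "\<And>f. f \<in> bloch_space \<alpha> \<Longrightarrow> wcomp u \<phi> f \<in> zyg_space \<beta>"
  obtains b where "0 < b"
    and "\<And>z. z \<in> udisk \<Longrightarrow> weight \<beta> z * cmod (deriv (deriv u) z) \<le> b"
    and "\<And>z. z \<in> udisk \<Longrightarrow>
      weight \<beta> z * cmod (2 * deriv u z * deriv \<phi> z + u z * deriv (deriv \<phi>) z) \<le> b"
    and "\<And>z. z \<in> udisk \<Longrightarrow> weight \<beta> z * cmod (u z * (deriv \<phi> z)\<^sup>2) \<le> b"
proof -
  define A where "A = (\<lambda>z. 2 * deriv u z * deriv \<phi> z + u z * deriv (deriv \<phi>) z)"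
  define B where "B = (\<lambda>z. u z * (deriv \<phi> z)\<^sup>2)"
  define N where "N = (\<lambda>n. zyg_norm \<beta> (wcomp u \<phi> (\<lambda>z. z ^ n)))"
  have N: "weight \<beta> z * cmod (deriv (deriv u) z * \<phi> z ^ n + A z * (of_nat n * \<phi> z ^ (n - 1))
      + B z * (of_nat n * (of_nat (n - 1) * \<phi> z ^ (n - 2)))) \<le> N n" if z: "z \<in> udisk" for z n
    using zyg_norm_ge(1)[OF maps[OF power_in_bloch_space[OF \<open>0 \<le> \<alpha>\<close>]] z, of n]
      deriv2_wcomp[OF u \<phi> _ z, of "\<lambda>z. z ^ n"]
    by (simp add: N_def A_def B_def deriv2_power) (simp add: deriv_power holomorphic_intros)
  have Nn: "0 \<le> N n" for n
    unfolding N_def by (rule zyg_norm_ge(2)[OF maps[OF power_in_bloch_space[OF \<open>0 \<le> \<alpha>\<close>]]])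
  have 0: "weight \<beta> z * cmod (deriv (deriv u) z) \<le> N 0" if "z \<in> udisk" for z
    using N[OF that, of 0] by simp
  have mul: "weight \<beta> z * cmod (x * \<phi> z ^ k) \<le> weight \<beta> z * cmod x" if "z \<in> udisk" for x z k
    using self_maps_in_udisk[OF \<phi> that]
    by (simp add: norm_mult norm_power mult_left_le power_le_one mult_left_mono)
  have 1: "weight \<beta> z * cmod (A z) \<le> N 1 + N 0" if z: "z \<in> udisk" for z
  proof -
    have "cmod (A z) \<le> cmod (deriv (deriv u) z * \<phi> z + A z) + cmod (deriv (deriv u) z * \<phi> z)"
      by (smt (verit) norm_triangle_ineq4 add_diff_cancel_left')
    then have "weight \<beta> z * cmod (A z) \<le> weight \<beta> z * (cmod (deriv (deriv u) z * \<phi> z + A z)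
        + cmod (deriv (deriv u) z * \<phi> z))"
      by (rule mult_left_mono) simp
    moreover have "weight \<beta> z * cmod (deriv (deriv u) z * \<phi> z ^ 1) \<le> N 0"
      using mul[OF z] 0[OF z] by (rule order_trans)
    ultimately show ?thesis
      using N[OF z, of 1] by (simp add: distrib_left)
  qed
  \<comment> \<open>\<open>N 2\<close> comes from the whole sum, \<open>N 0\<close> from the u''
    term and 2 * (N 1 + N 0) from the A term; the factor 2 in front of |B| is given away.\<close>
  have 2: "weight \<beta> z * cmod (B z) \<le> N 2 + 3 * N 0 + 2 * N 1" if z: "z \<in> udisk" for z
  proof -
    let ?S = "deriv (deriv u) z * \<phi> z ^ 2 + A z * (2 * \<phi> z) + B z * 2"
    have "2 * cmod (B z) = cmod (?S - deriv (deriv u) z * \<phi> z ^ 2 - 2 * (A z * \<phi> z))"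
      by (simp add: norm_mult algebra_simps)
    also have "\<dots> \<le> cmod ?S + cmod (deriv (deriv u) z * \<phi> z ^ 2) + cmod (2 * (A z * \<phi> z))"
      by (meson add_right_mono norm_triangle_ineq4 order_trans)
    finally have "cmod (B z) \<le> cmod ?S + cmod (deriv (deriv u) z * \<phi> z ^ 2) + 2 * cmod (A z * \<phi> z)"
      unfolding norm_mult[of 2] by simp (use norm_ge_zero[of "B z"] in linarith)
    then have "weight \<beta> z * cmod (B z) \<le> weight \<beta> z * (cmod ?S
        + cmod (deriv (deriv u) z * \<phi> z ^ 2) + 2 * cmod (A z * \<phi> z))"
      by (rule mult_left_mono) simp
    moreover have "weight \<beta> z * cmod (deriv (deriv u) z * \<phi> z ^ 2) \<le> N 0"
      using mul[OF z] 0[OF z] by (rule order_trans)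
    moreover have "weight \<beta> z * cmod (A z * \<phi> z ^ 1) \<le> N 1 + N 0"
      using mul[OF z] 1[OF z] by (rule order_trans)
    ultimately show ?thesis
      using N[OF z, of 2] by (simp add: algebra_simps)
  qed
  \<comment> \<open>The added 1 makes the common bound strictly positive, so that it can be divided
    by.\<close>
  have "0 < N 2 + 3 * N 0 + 2 * N 1 + 1"
    using Nn[of 0] Nn[of 1] Nn[of 2] by simp
  moreover have "weight \<beta> z * cmod (deriv (deriv u) z) \<le> N 2 + 3 * N 0 + 2 * N 1 + 1"
    "weight \<beta> z * cmod (A z) \<le> N 2 + 3 * N 0 + 2 * N 1 + 1"
    "weight \<beta> z * cmod (B z) \<le> N 2 + 3 * N 0 + 2 * N 1 + 1" if "z \<in> udisk" for z
    using 0[OF that] 1[OF that] 2[OF that] Nn[of 0] Nn[of 1] Nn[of 2] by linarith+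
  ultimately show thesis
    using that unfolding A_def B_def by blast
qed

section \<open>Compact operators and differences of test functions\<close>

lemma linear_op_onD:
  assumes "linear_op_on X Y T" "f \<in> X" "g \<in> X" "z \<in> udisk"
  shows "T (\<lambda>w. a * f w + b * g w) z = a * T f z + b * T g z"
  using assms unfolding linear_op_on_def by simp

text \<open>\<open>cpt_wop\<close> speaks of subsequences only, whereas \<open>wop_norm\<close> is a
  real supremum and needs a bounded set. If the set were unbounded, images of norm above n could be
  chosen for every n; along a convergent subsequence their norms are eventually below that of the
  limit plus 1.\<close>

lemma cpt_wop_bdd_above:
  assumes "cpt_wop X nX (zyg_space \<beta>) (zyg_norm \<beta>) K"
  shows "bdd_above ((\<lambda>f. zyg_norm \<beta> (K f)) ` {f \<in> X. nX f \<le> 1})"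
proof (rule ccontr)
  assume "\<not> ?thesis"
  then have "\<forall>n::nat. \<exists>f\<in>X. nX f \<le> 1 \<and> real n < zyg_norm \<beta> (K f)"
    by (auto simp: bdd_above_def not_le)
  then obtain s where s: "\<And>n::nat. s n \<in> X \<and> nX (s n) \<le> 1 \<and> real n < zyg_norm \<beta> (K (s n))"
    by metis
  then obtain r g where r: "strict_mono r" and g: "g \<in> zyg_space \<beta>"
    and lim: "(\<lambda>n. zyg_norm \<beta> (\<lambda>z. K (s (r n)) z - g z)) \<longlonglongrightarrow> 0"
    using assms unfolding cpt_wop_def by meson
  have Ks: "K (s n) \<in> zyg_space \<beta>" for n
    using assms s unfolding cpt_wop_def linear_op_on_def by blast
  have "\<forall>\<^sub>F n in sequentially. zyg_norm \<beta> (\<lambda>z. K (s (r n)) z - g z) < 1"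
    using lim by (rule order_tendstoD) simp
  moreover have "\<forall>\<^sub>F n in sequentially. zyg_norm \<beta> g + 1 \<le> real n"
    by (meson eventually_at_top_linorder eventually_sequentiallyI nat_ceiling_le_eq)
  ultimately have "\<forall>\<^sub>F n::nat in sequentially. False"
  proof eventually_elim
    case (elim n)
    have diff: "(\<lambda>z. K (s (r n)) z - g z) \<in> zyg_space \<beta>"
      using zyg_lincomb(1)[OF Ks[of "r n"] g, of 1 "-1"] by simp
    have "zyg_norm \<beta> (K (s (r n))) \<le> zyg_norm \<beta> (\<lambda>z. K (s (r n)) z - g z) + zyg_norm \<beta> g"
      using zyg_lincomb(2)[OF diff g, of 1 1] by simp
    moreover have "real n \<le> real (r n)"
      using seq_suble[OF r] by simp
    ultimately show False
      using elim s[of "r n"] by linarith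
  qed
  then show False by simp
qed

lemma zyg_norm_le_wop_norm:
  assumes T: "bdd_wop X nX (zyg_space \<beta>) (zyg_norm \<beta>) T"
    and K: "cpt_wop X nX (zyg_space \<beta>) (zyg_norm \<beta>) K"
    and f: "f \<in> X" "nX f \<le> 1"
  shows "zyg_norm \<beta> (\<lambda>z. T f z - K f z) \<le> wop_norm X nX (zyg_norm \<beta>) (\<lambda>f z. T f z - K f z)"
proof -
  obtain a b where a: "\<And>f. f \<in> X \<Longrightarrow> nX f \<le> 1 \<Longrightarrow> zyg_norm \<beta> (T f) \<le> a"
    and b: "\<And>f. f \<in> X \<Longrightarrow> nX f \<le> 1 \<Longrightarrow> zyg_norm \<beta> (K f) \<le> b"
    using T cpt_wop_bdd_above[OF K] unfolding bdd_wop_def bdd_above_def by auto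
  have "zyg_norm \<beta> (\<lambda>z. T f z - K f z) \<le> a + b" if "f \<in> X" "nX f \<le> 1" for f
  proof -
    have "T f \<in> zyg_space \<beta>" "K f \<in> zyg_space \<beta>"
      using T K that unfolding bdd_wop_def cpt_wop_def linear_op_on_def by blast+
    from zyg_lincomb(2)[OF this, of 1 "-1"] a[OF that] b[OF that] show ?thesis by simp
  qed
  then have "bdd_above ((\<lambda>f. zyg_norm \<beta> (\<lambda>z. T f z - K f z)) ` {f \<in> X. nX f \<le> 1})"
    by (auto intro!: bdd_aboveI)
  then show ?thesis
    unfolding wop_norm_def using f by (intro cSUP_upper) auto
qed

text \<open>The factor 1/2 keeps differences inside the unit ball, where both compactness and
  \<open>wop_norm\<close> are formulated. If both functions vanish at 0, the norm reduces to the
  derivative part, which the factor 1/2 averages.\<close>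

lemma bloch_half_diff:
  assumes "f \<in> bloch_space \<alpha>" "g \<in> bloch_space \<alpha>" "bloch_norm \<alpha> f \<le> 1" "bloch_norm \<alpha> g \<le> 1"
  shows "(\<lambda>w. 1/2 * f w + (- 1/2) * g w) \<in> bloch_space \<alpha>"
    and "f 0 = 0 \<Longrightarrow> g 0 = 0 \<Longrightarrow> bloch_norm \<alpha> (\<lambda>w. 1/2 * f w + (- 1/2) * g w) \<le> 1"
proof -
  let ?h = "\<lambda>w. 1/2 * f w + (- 1/2) * g w"
  have holo: "f holomorphic_on udisk" "g holomorphic_on udisk"
    using assms by (auto simp: bloch_space_def)
  have le: "weight \<alpha> z * cmod (deriv ?h z) \<le> 1" if z: "z \<in> udisk" for z
  proof -
    have "weight \<alpha> z * cmod (deriv ?h z)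
        \<le> weight \<alpha> z * (1/2 * cmod (deriv f z) + 1/2 * cmod (deriv g z))"
      unfolding deriv_lincomb[OF holo z]
      by (intro mult_left_mono order_trans[OF norm_triangle_ineq]) (auto simp: norm_mult)
    also have "\<dots> = 1/2 * (weight \<alpha> z * cmod (deriv f z)) + 1/2 * (weight \<alpha> z * cmod (deriv g z))"
      by (simp add: algebra_simps)
    also have "\<dots> \<le> 1"
      using bloch_norm_ge[OF assms(1) z] bloch_norm_ge[OF assms(2) z] assms(3,4) by linarith
    finally show ?thesis .
  qed
  show "?h \<in> bloch_space \<alpha>"
    by (rule bloch_spaceI[OF _ le]) (auto intro!: holomorphic_intros holo)
  assume "f 0 = 0" "g 0 = 0"
  then show "bloch_norm \<alpha> ?h \<le> 1"
    using bloch_norm_le[OF le] by simp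
qed

text \<open>Replaces the usual appeal to weakly null sequences: along a subsequence on which
  \<^term>\<open>K\<close> converges, the differences of two members are almost annihilated by \<^term>\<open>K\<close>.\<close>

lemma cpt_wop_subseq_diff:
  assumes T: "bdd_wop (bloch_space \<alpha>) (bloch_norm \<alpha>) (zyg_space \<beta>) (zyg_norm \<beta>) T"
    and K: "cpt_wop (bloch_space \<alpha>) (bloch_norm \<alpha>) (zyg_space \<beta>) (zyg_norm \<beta>) K"
    and s: "\<And>n::nat. s n \<in> bloch_space \<alpha>" "\<And>n. bloch_norm \<alpha> (s n) \<le> 1" "\<And>n. s n 0 = 0"
    and "0 < e"
  shows "\<exists>(r :: nat \<Rightarrow> nat) N. strict_mono r \<and> (\<forall>k\<ge>N. \<forall>l\<ge>N. \<forall>z\<in>udisk.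
      weight \<beta> z * cmod (deriv (deriv (T (s (r k)))) z - deriv (deriv (T (s (r l)))) z)
      \<le> 2 * wop_norm (bloch_space \<alpha>) (bloch_norm \<alpha>) (zyg_norm \<beta>) (\<lambda>f z. T f z - K f z) + e)"
proof -
  define L where
    "L = wop_norm (bloch_space \<alpha>) (bloch_norm \<alpha>) (zyg_norm \<beta>) (\<lambda>f z. T f z - K f z)"
  have linT: "linear_op_on (bloch_space \<alpha>) (zyg_space \<beta>) T"
    and linK: "linear_op_on (bloch_space \<alpha>) (zyg_space \<beta>) K"
    using T K by (auto simp: bdd_wop_def cpt_wop_def)
  obtain r g where r: "strict_mono (r :: nat \<Rightarrow> nat)" and g: "g \<in> zyg_space \<beta>"
    and lim: "(\<lambda>n. zyg_norm \<beta> (\<lambda>z. K (s (r n)) z - g z)) \<longlonglongrightarrow> 0"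
    using K s unfolding cpt_wop_def by meson
  have "\<forall>\<^sub>F n in sequentially. zyg_norm \<beta> (\<lambda>z. K (s (r n)) z - g z) < e / 2"
    using lim by (rule order_tendstoD) (use \<open>0 < e\<close> in simp)
  then obtain N where N: "\<And>n. n \<ge> N \<Longrightarrow> zyg_norm \<beta> (\<lambda>z. K (s (r n)) z - g z) < e / 2"
    by (auto simp: eventually_sequentially)
  have Ts: "T f \<in> zyg_space \<beta>" and Ks: "K f \<in> zyg_space \<beta>" if "f \<in> bloch_space \<alpha>" for f
    using linT linK that by (auto simp: linear_op_on_def)
  have "weight \<beta> z * cmod (deriv (deriv (T (s (r k)))) z - deriv (deriv (T (s (r l)))) z) \<le> 2 * L + e"
    if k: "k \<ge> N" and l: "l \<ge> N" and z: "z \<in> udisk" for k l z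
  proof -
    let ?f = "s (r k)" and ?g = "s (r l)"
    \<comment> \<open>Undoing the half at the end turns L + e / 2 into 2 * L + e.\<close>
    define h where "h = (\<lambda>w. 1/2 * ?f w + (- 1/2) * ?g w)"
    have h: "h \<in> bloch_space \<alpha>" "bloch_norm \<alpha> h \<le> 1"
      unfolding h_def using s by (intro bloch_half_diff; simp)+
    \<comment> \<open>The limit \<open>g\<close> is inserted twice and cancels, so nothing about its
      values has to be known.\<close>
    have Klin: "K h w = 1/2 * (K ?f w - g w) + (- 1/2) * (K ?g w - g w)" if "w \<in> udisk" for w
    proof -
      have "K h w = 1/2 * K ?f w + (- 1/2) * K ?g w"
        unfolding h_def using linK s(1) s(1) that by (rule linear_op_onD)
      then show ?thesis by (simp add: algebra_simps)
    qed
    have Tlin: "T h w = 1/2 * T ?f w + (- 1/2) * T ?g w" if "w \<in> udisk" for w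
      unfolding h_def using linT s(1) s(1) that by (rule linear_op_onD)
    have diff: "(\<lambda>z. K (s n) z - g z) \<in> zyg_space \<beta>" for n
      using zyg_lincomb(1)[OF Ks[OF s(1)[of n]] g, of 1 "- 1"] by simp
    have "zyg_norm \<beta> (K h) = zyg_norm \<beta> (\<lambda>w. 1/2 * (K ?f w - g w) + (- 1/2) * (K ?g w - g w))"
      by (rule zyg_norm_cong) (rule Klin)
    also have "\<dots> \<le> cmod (1/2) * zyg_norm \<beta> (\<lambda>w. K ?f w - g w)
        + cmod (- 1/2) * zyg_norm \<beta> (\<lambda>w. K ?g w - g w)"
      by (rule zyg_lincomb(2)[OF diff[of "r k"] diff[of "r l"]])
    also have "\<dots> \<le> e / 2"
      using N[OF k] N[OF l] by simp
    finally have Kh: "zyg_norm \<beta> (K h) \<le> e / 2" .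
    have TK: "(\<lambda>z. T h z - K h z) \<in> zyg_space \<beta>"
      using zyg_lincomb(1)[OF Ts[OF h(1)] Ks[OF h(1)], of 1 "-1"] by simp
    have TKh: "zyg_norm \<beta> (\<lambda>z. T h z - K h z) \<le> L"
      unfolding L_def by (rule zyg_norm_le_wop_norm[OF T K h])
    have "zyg_norm \<beta> (T h) \<le> zyg_norm \<beta> (\<lambda>z. T h z - K h z) + zyg_norm \<beta> (K h)"
      using zyg_lincomb(2)[OF TK Ks[OF h(1)], of 1 1] by simp
    with TKh Kh zyg_norm_ge(1)[OF Ts[OF h(1)] z]
    have le: "weight \<beta> z * cmod (deriv (deriv (T h)) z) \<le> L + e / 2" by linarith
    have holo: "T ?f holomorphic_on udisk" "T ?g holomorphic_on udisk"
      using Ts s(1) by (auto simp: zyg_space_def)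
    have "deriv (T h) w = deriv (\<lambda>w. 1/2 * T ?f w + (- 1/2) * T ?g w) w" if "w \<in> udisk" for w
      using Tlin that by (rule deriv_cong_udisk)
    then have "deriv (deriv (T h)) z = deriv (deriv (\<lambda>w. 1/2 * T ?f w + (- 1/2) * T ?g w)) z"
      using z by (rule deriv_cong_udisk)
    also have "\<dots> = 1/2 * deriv (deriv (T ?f)) z + (- 1/2) * deriv (deriv (T ?g)) z"
      by (rule deriv2_lincomb[OF holo z])
    also have "\<dots> = 1/2 * (deriv (deriv (T ?f)) z - deriv (deriv (T ?g)) z)"
      by (simp add: algebra_simps)
    finally have "cmod (deriv (deriv (T h)) z)
        = 1/2 * cmod (deriv (deriv (T ?f)) z - deriv (deriv (T ?g)) z)"
      by (simp only: norm_mult) simp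
    then have "weight \<beta> z * cmod (deriv (deriv (T ?f)) z - deriv (deriv (T ?g)) z)
        = 2 * (weight \<beta> z * cmod (deriv (deriv (T h)) z))" by simp
    with le show ?thesis by linarith
  qed
  with r show ?thesis unfolding L_def by blast
qed

section \<open>Normalised monomials and their images\<close>

text \<open>The passage between the extended real quantities of the final statement and the
  pointwise real estimates in which all the analysis is done.\<close>

lemma nu_norm_le_iff:
  assumes "0 < c"
  shows "ereal c * nu_norm \<beta> g \<le> ereal k \<longleftrightarrow> (\<forall>z\<in>udisk. c * (weight \<beta> z * cmod (g z)) \<le> k)"
proof
  assume le: "ereal c * nu_norm \<beta> g \<le> ereal k"
  show "\<forall>z\<in>udisk. c * (weight \<beta> z * cmod (g z)) \<le> k"
  proof
    fix z :: complex assume "z \<in> udisk"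
    then have "ereal (weight \<beta> z * cmod (g z)) \<le> nu_norm \<beta> g"
      unfolding nu_norm_def by (rule SUP_upper)
    then have "ereal c * ereal (weight \<beta> z * cmod (g z)) \<le> ereal c * nu_norm \<beta> g"
      using assms by (intro ereal_mult_left_mono) auto
    with le have "ereal c * ereal (weight \<beta> z * cmod (g z)) \<le> ereal k" by (rule order_trans[rotated])
    then show "c * (weight \<beta> z * cmod (g z)) \<le> k" by simp
  qed
next
  assume "\<forall>z\<in>udisk. c * (weight \<beta> z * cmod (g z)) \<le> k"
  then have "nu_norm \<beta> g \<le> ereal (k / c)"
    unfolding nu_norm_def using assms by (intro SUP_least) (auto simp: field_simps)
  then have "ereal c * nu_norm \<beta> g \<le> ereal c * ereal (k / c)"
    using assms by (intro ereal_mult_left_mono) auto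
  then show "ereal c * nu_norm \<beta> g \<le> ereal k"
    using assms by simp
qed

text \<open>Each of the n summands of the geometric sum 1 + t + ... + t^(n-1) is at least t^(n-1),
  hence n t^(n-1) (1 - t) <= 1 - t^n <= 1. Raising this to the power alpha gives the decay
  n^(-alpha); t^(n-1) is at most its own power alpha because it lies in [0,1]. The 2 bounds (1 +
  t)^alpha.\<close>

lemma powr_mult_power_le:
  fixes t \<alpha> :: real
  assumes \<alpha>: "0 < \<alpha>" "\<alpha> < 1" and t: "0 \<le> t" "t < 1" and n: "0 < n"
  shows "(1 - t\<^sup>2) powr \<alpha> * t ^ (n - 1) \<le> 2 * real n powr (- \<alpha>)"
proof -
  have t1: "t ^ (n - 1) \<le> 1" using t by (simp add: power_le_one)
  have "real n * t ^ (n - 1) = (\<Sum>k<n. t ^ (n - 1))" by simp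
  also have "\<dots> \<le> (\<Sum>k<n. t ^ k)"
    using t by (intro sum_mono power_decreasing) auto
  finally have "real n * t ^ (n - 1) * (1 - t) \<le> (\<Sum>k<n. t ^ k) * (1 - t)"
    using t by (intro mult_right_mono) auto
  also have "\<dots> = 1 - t ^ n"
    by (metis mult.commute one_diff_power_eq)
  also have "\<dots> \<le> 1" using t by simp
  finally have le: "t ^ (n - 1) * (1 - t) \<le> 1 / real n"
    using n by (simp add: field_simps)
  have "1 - t\<^sup>2 = (1 + t) * (1 - t)" by (simp add: power2_eq_square algebra_simps)
  moreover have "(1 + t) * (1 - t) \<le> 2 * (1 - t)" "0 \<le> (1 + t) * (1 - t)"
    using t by (auto intro: mult_right_mono simp del: right_diff_distrib_numeral)
  ultimately have "1 - t\<^sup>2 \<le> 2 * (1 - t)" "0 \<le> 1 - t\<^sup>2" by simp_all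
  then have "(1 - t\<^sup>2) powr \<alpha> \<le> (2 * (1 - t)) powr \<alpha>"
    using \<alpha> by (intro powr_mono2) auto
  also have "\<dots> = 2 powr \<alpha> * (1 - t) powr \<alpha>"
    by (rule powr_mult)
  also have "2 powr \<alpha> \<le> 2 powr (1::real)"
    using \<alpha> by (intro powr_mono) auto
  finally have 1: "(1 - t\<^sup>2) powr \<alpha> \<le> 2 * (1 - t) powr \<alpha>"
    by (simp add: mult_right_mono)
  have 2: "t ^ (n - 1) \<le> (t ^ (n - 1)) powr \<alpha>"
  proof (cases "t ^ (n - 1) = 0")
    case False
    with t have "0 < t ^ (n - 1)" by (metis zero_le_power less_eq_real_def)
    then show ?thesis
      using powr_mono'[of \<alpha> 1 "t ^ (n - 1)"] \<alpha> t1 by simp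
  next
    case True
    show ?thesis unfolding True by simp
  qed
  have "(1 - t\<^sup>2) powr \<alpha> * t ^ (n - 1) \<le> (2 * (1 - t) powr \<alpha>) * (t ^ (n - 1)) powr \<alpha>"
    using 1 2 t by (intro mult_mono) auto
  also have "\<dots> = 2 * (t ^ (n - 1) * (1 - t)) powr \<alpha>"
    using t by (simp add: powr_mult mult.commute)
  also have "\<dots> \<le> 2 * (1 / real n) powr \<alpha>"
    using le t \<alpha> by (intro mult_left_mono powr_mono2) auto
  also have "(1 / real n) powr \<alpha> = real n powr (- \<alpha>)"
    using n by (simp add: powr_divide powr_minus inverse_eq_divide)
  finally show ?thesis .
qed

text \<open>The derivative of z^n has weighted size at most n * 2 n^(-alpha) by
  \<open>powr_mult_power_le\<close>; the scalar cancels exactly this, so the norm is at most 1. For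
  \<open>n = 0\<close> the convention 0 powr x = 0 makes the function zero, hence all of them vanish
  at 0.\<close>

definition bloch_monomial :: "real \<Rightarrow> nat \<Rightarrow> complex \<Rightarrow> complex" where
  "bloch_monomial \<alpha> n = (\<lambda>z. of_real (real n powr (\<alpha> - 1) / 2) * z ^ n)"

lemma deriv_bloch_monomial:
  "deriv (bloch_monomial \<alpha> n)
    = (\<lambda>z. of_real (real n powr (\<alpha> - 1) / 2) * (of_nat n * z ^ (n - 1)))"
  unfolding bloch_monomial_def
  by (rule ext, rule DERIV_imp_deriv) (auto intro!: derivative_eq_intros)

lemma deriv2_bloch_monomial:
  "deriv (deriv (bloch_monomial \<alpha> n)) z
    = of_real (real n powr (\<alpha> - 1) / 2) * (of_nat n * (of_nat (n - 1) * z ^ (n - 2)))"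
  unfolding deriv_bloch_monomial
  by (rule DERIV_imp_deriv) (auto intro!: derivative_eq_intros simp: numeral_2_eq_2)

lemma bloch_monomial_0: "bloch_monomial \<alpha> n 0 = 0"
  by (cases n) (auto simp: bloch_monomial_def)

lemma holomorphic_bloch_monomial: "bloch_monomial \<alpha> n holomorphic_on S"
  unfolding bloch_monomial_def by (intro holomorphic_intros)

lemma
  assumes "0 < \<alpha>" "\<alpha> < 1"
  shows bloch_monomial_in_space: "bloch_monomial \<alpha> n \<in> bloch_space \<alpha>"
    and bloch_norm_monomial_le_1: "bloch_norm \<alpha> (bloch_monomial \<alpha> n) \<le> 1"
proof -
  have le: "weight \<alpha> z * cmod (deriv (bloch_monomial \<alpha> n) z) \<le> 1" if z: "z \<in> udisk" for z
  proof (cases "n = 0")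
    case False
    then have n: "0 < n" by simp
    have "weight \<alpha> z * cmod (deriv (bloch_monomial \<alpha> n) z)
        = (real n powr (\<alpha> - 1) * real n / 2) * (weight \<alpha> z * cmod z ^ (n - 1))"
      by (simp add: deriv_bloch_monomial norm_mult norm_power)
    also have "\<dots> \<le> (real n powr (\<alpha> - 1) * real n / 2) * (2 * real n powr (- \<alpha>))"
      using z by (intro mult_left_mono powr_mult_power_le assms n) auto
    also have "\<dots> = real n powr (\<alpha> - 1) * real n powr 1 * real n powr (- \<alpha>)"
      using n by simp
    also have "\<dots> = 1"
      using n unfolding powr_add[symmetric] by simp
    finally show ?thesis .
  qed (simp add: deriv_bloch_monomial)
  show "bloch_monomial \<alpha> n \<in> bloch_space \<alpha>"
    by (rule bloch_spaceI[OF holomorphic_bloch_monomial le])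
  show "bloch_norm \<alpha> (bloch_monomial \<alpha> n) \<le> 1"
    using bloch_norm_le[OF le] by (simp add: bloch_monomial_0)
qed

lemma deriv2_wcomp_bloch_monomial:
  assumes "u holomorphic_on udisk" "\<phi> \<in> self_maps" "z \<in> udisk"
  shows "deriv (deriv (wcomp u \<phi> (bloch_monomial \<alpha> n))) z
    = of_real (real n powr (\<alpha> - 1) / 2) * (deriv (deriv u) z * \<phi> z ^ n
      + (of_nat n * (2 * deriv u z * deriv \<phi> z + u z * deriv (deriv \<phi>) z) * \<phi> z ^ (n - 1)
        + of_nat n * of_nat (n - 1) * (u z * (deriv \<phi> z)\<^sup>2) * \<phi> z ^ (n - 2)))"
  unfolding deriv2_wcomp[OF assms(1,2) holomorphic_bloch_monomial assms(3)] deriv2_bloch_monomial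
  unfolding deriv_bloch_monomial
  by (simp add: bloch_monomial_def algebra_simps)

text \<open>The quadratic factor is reduced to the linear case: n^2 x^n is the square of n y^n with
  y a square root of x. The limit is computed at index n + 2, where the truncated subtractions n - 1
  and n - 2 are harmless.\<close>

lemma tendsto_monomial_terms_0:
  fixes x :: complex
  assumes "cmod x < 1"
  shows "(\<lambda>n. p * x ^ n + (of_nat n * a * x ^ (n - 1)
    + of_nat n * of_nat (n - 1) * b * x ^ (n - 2))) \<longlonglongrightarrow> 0"
proof -
  have 0: "(\<lambda>n. x ^ n) \<longlonglongrightarrow> 0"
    using assms by (rule LIMSEQ_power_zero)
  have 1: "(\<lambda>n. of_nat n * x ^ n) \<longlonglongrightarrow> 0"
    using assms by (rule powser_times_n_limit_0)
  have "cmod (csqrt x) < 1"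
    using assms by simp
  then have "(\<lambda>n. (of_nat n * csqrt x ^ n)\<^sup>2) \<longlonglongrightarrow> 0\<^sup>2"
    by (intro tendsto_power powser_times_n_limit_0)
  also have "(\<lambda>n. (of_nat n * csqrt x ^ n)\<^sup>2) = (\<lambda>n. (of_nat n)\<^sup>2 * x ^ n)"
  proof
    fix n :: nat
    have "(csqrt x ^ n)\<^sup>2 = x ^ n"
      by (metis power2_csqrt power_mult mult.commute)
    then show "(of_nat n * csqrt x ^ n)\<^sup>2 = (of_nat n)\<^sup>2 * x ^ n"
      by (simp add: power_mult_distrib)
  qed
  finally have 2: "(\<lambda>n. (of_nat n)\<^sup>2 * x ^ n) \<longlonglongrightarrow> 0" by simp
  have "(\<lambda>n. p * x\<^sup>2 * x ^ n + (a * x * (of_nat n * x ^ n) + 2 * a * x * x ^ n)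
      + b * ((of_nat n)\<^sup>2 * x ^ n + 3 * (of_nat n * x ^ n) + 2 * x ^ n))
      \<longlonglongrightarrow> p * x\<^sup>2 * 0 + (a * x * 0 + 2 * a * x * 0) + b * (0 + 3 * 0 + 2 * 0)"
    by (intro tendsto_intros 0 1 2)
  then have "(\<lambda>n. p * x ^ (n + 2) + (of_nat (n + 2) * a * x ^ (n + 2 - 1)
    + of_nat (n + 2) * of_nat (n + 2 - 1) * b * x ^ (n + 2 - 2))) \<longlonglongrightarrow> 0"
    by (simp add: algebra_simps power2_eq_square)
  then show ?thesis by (rule LIMSEQ_offset)
qed

section \<open>Lower estimate: one bound for A and B together, then their separation\<close>

text \<open>If the bound failed for infinitely many n, a subsequence of these exponents would
  satisfy the difference estimate uniformly in z. Fixing one exponent together with a point z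
  violating the bound, and letting the other exponent tend to infinity, contradicts the violation.
  Of the factor 4, one 2 is from the difference estimate and one 2 undoes the 1/2 in
  \<open>bloch_monomial\<close>. The u'' term is missing from the bound since it carries the
  vanishing factor n^(alpha-1).\<close>

lemma eventually_monomial_bound:
  fixes \<alpha> \<beta> :: real
  assumes \<alpha>: "0 < \<alpha>" "\<alpha> < 1" and u: "u holomorphic_on udisk" and \<phi>: "\<phi> \<in> self_maps"
    and T: "bdd_wop (bloch_space \<alpha>) (bloch_norm \<alpha>) (zyg_space \<beta>) (zyg_norm \<beta>) (wcomp u \<phi>)"
    and K: "cpt_wop (bloch_space \<alpha>) (bloch_norm \<alpha>) (zyg_space \<beta>) (zyg_norm \<beta>) K"
    and e: "0 < e"
  defines "L \<equiv> wop_norm (bloch_space \<alpha>) (bloch_norm \<alpha>) (zyg_norm \<beta>) (\<lambda>f z. wcomp u \<phi> f z - K f z)"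
  shows "\<forall>\<^sub>F n in sequentially. \<forall>z\<in>udisk. real n powr (\<alpha> - 1) * (weight \<beta> z *
    cmod (of_nat n * (2 * deriv u z * deriv \<phi> z + u z * deriv (deriv \<phi>) z) * \<phi> z ^ (n - 1)
      + of_nat n * of_nat (n - 1) * (u z * (deriv \<phi> z)\<^sup>2) * \<phi> z ^ (n - 2))) \<le> 4 * L + e"
proof (rule ccontr)
  define D where "D = (\<lambda>n z. of_nat n * (2 * deriv u z * deriv \<phi> z + u z * deriv (deriv \<phi>) z) * \<phi> z ^ (n - 1)
      + of_nat n * of_nat (n - 1) * (u z * (deriv \<phi> z)\<^sup>2) * \<phi> z ^ (n - 2))"
  define S where "S = {n. \<exists>z\<in>udisk. 4 * L + e < real n powr (\<alpha> - 1) * (weight \<beta> z * cmod (D n z))}"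
  assume "\<not> ?thesis"
  then have "infinite S"
    unfolding infinite_nat_iff_unbounded_le S_def D_def eventually_sequentially
    by (force simp: not_le)
  then obtain p :: "nat \<Rightarrow> nat" where p: "strict_mono p" "\<And>n. p n \<in> S"
    using infinite_enumerate by blast
  have D2: "deriv (deriv (wcomp u \<phi> (bloch_monomial \<alpha> n))) z
      = of_real (real n powr (\<alpha> - 1) / 2) * (deriv (deriv u) z * \<phi> z ^ n + D n z)"
    if "z \<in> udisk" for n z
    unfolding D_def using u \<phi> that by (rule deriv2_wcomp_bloch_monomial)
  have maps: "wcomp u \<phi> f \<in> zyg_space \<beta>" if "f \<in> bloch_space \<alpha>" for f
    using T that by (auto simp: bdd_wop_def linear_op_on_def)
  obtain b where "0 < b" and b: "\<And>z. z \<in> udisk \<Longrightarrow> weight \<beta> z * cmod (deriv (deriv u) z) \<le> b"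
    by (rule wcomp_coefficients_bounded[OF u \<phi> less_imp_le[OF \<alpha>(1)] maps]) (assumption | rule that)+
  \<comment> \<open>The error budget: e / 8 is doubled to e / 4, and the u'' term adds at most
    another e / 4, which stays below e.\<close>
  have "\<exists>(r :: nat \<Rightarrow> nat) N. strict_mono r \<and> (\<forall>k\<ge>N. \<forall>l\<ge>N. \<forall>z\<in>udisk.
      weight \<beta> z * cmod (deriv (deriv (wcomp u \<phi> (bloch_monomial \<alpha> (p (r k))))) z
        - deriv (deriv (wcomp u \<phi> (bloch_monomial \<alpha> (p (r l))))) z) \<le> 2 * L + e / 8)"
    unfolding L_def
    by (rule cpt_wop_subseq_diff[where s = "\<lambda>n. bloch_monomial \<alpha> (p n)", OF T K
          bloch_monomial_in_space[OF \<alpha>] bloch_norm_monomial_le_1[OF \<alpha>] bloch_monomial_0])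
       (use e in simp)
  then obtain r :: "nat \<Rightarrow> nat" and N where r: "strict_mono r"
    and N: "\<forall>k\<ge>N. \<forall>l\<ge>N. \<forall>z\<in>udisk.
      weight \<beta> z * cmod (deriv (deriv (wcomp u \<phi> (bloch_monomial \<alpha> (p (r k))))) z
        - deriv (deriv (wcomp u \<phi> (bloch_monomial \<alpha> (p (r l))))) z) \<le> 2 * L + e / 8"
    by (elim exE conjE)
  define q where "q = p \<circ> r"
  have q: "strict_mono q" unfolding q_def by (rule strict_mono_o[OF p(1) r])
  have "(\<lambda>n. real n powr (\<alpha> - 1)) \<longlonglongrightarrow> 0"
    using \<alpha> by (intro tendsto_neg_powr filterlim_real_sequentially) auto
  then have c0: "(\<lambda>k. real (q k) powr (\<alpha> - 1)) \<longlonglongrightarrow> 0"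
    using LIMSEQ_subseq_LIMSEQ[OF _ q] by (simp add: o_def)
  then have "\<forall>\<^sub>F k in sequentially. real (q k) powr (\<alpha> - 1) < e / (4 * b)"
    by (rule order_tendstoD) (use e \<open>0 < b\<close> in simp)
  then have "\<forall>\<^sub>F k in sequentially. k \<ge> N \<and> real (q k) powr (\<alpha> - 1) < e / (4 * b)"
    using eventually_ge_at_top[of N] by eventually_elim simp
  then obtain k where k: "k \<ge> N" "real (q k) powr (\<alpha> - 1) < e / (4 * b)"
    by (auto dest: eventually_happens)
  have "q k \<in> S" using p(2) by (simp add: q_def)
  then obtain z where z: "z \<in> udisk"
    and big: "4 * L + e < real (q k) powr (\<alpha> - 1) * (weight \<beta> z * cmod (D (q k) z))"
    unfolding S_def by blast
  define V where "V = (\<lambda>l. deriv (deriv (wcomp u \<phi> (bloch_monomial \<alpha> (q l)))) z)"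
  have "cmod (\<phi> z) < 1" using self_maps_in_udisk[OF \<phi> z] by simp
  then have "(\<lambda>n. deriv (deriv u) z * \<phi> z ^ n + D n z) \<longlonglongrightarrow> 0"
    unfolding D_def by (rule tendsto_monomial_terms_0)
  then have "(\<lambda>l. deriv (deriv u) z * \<phi> z ^ q l + D (q l) z) \<longlonglongrightarrow> 0"
    using LIMSEQ_subseq_LIMSEQ[OF _ q] by (simp add: o_def)
  then have "(\<lambda>l. of_real (real (q l) powr (\<alpha> - 1) / 2) * (deriv (deriv u) z * \<phi> z ^ q l + D (q l) z))
      \<longlonglongrightarrow> of_real (0 / 2) * 0"
    by (intro tendsto_mult tendsto_of_real tendsto_divide tendsto_const c0) auto
  then have "V \<longlonglongrightarrow> 0"
    unfolding V_def D2[OF z] by simp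
  \<comment> \<open>Here \<open>k\<close> and \<open>z\<close> stay fixed; pointwise convergence in
    \<open>l\<close> suffices because the difference estimate holds at every z for the same range of
    indices.\<close>
  then have "(\<lambda>l. weight \<beta> z * cmod (V k - V l)) \<longlonglongrightarrow> weight \<beta> z * cmod (V k - 0)"
    by (intro tendsto_intros)
  moreover have "\<forall>\<^sub>F l in sequentially. weight \<beta> z * cmod (V k - V l) \<le> 2 * L + e / 8"
    unfolding eventually_sequentially V_def q_def o_def using N k(1) z by blast
  ultimately have "weight \<beta> z * cmod (V k - 0) \<le> 2 * L + e / 8"
    by (rule tendsto_upperbound) simp
  then have Vk: "weight \<beta> z * cmod (V k) \<le> 2 * L + e / 8" by simp
  define c where "c = real (q k) powr (\<alpha> - 1)"
  have c: "0 \<le> c" "c * b \<le> e / 4"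
    using k(2) \<open>0 < b\<close> by (auto simp: c_def field_simps)
  have "of_real (c / 2) * D (q k) z = V k - of_real (c / 2) * (deriv (deriv u) z * \<phi> z ^ q k)"
    unfolding V_def D2[OF z] c_def by (simp add: algebra_simps)
  then have "cmod (of_real (c / 2) * D (q k) z)
      \<le> cmod (V k) + cmod (of_real (c / 2) * (deriv (deriv u) z * \<phi> z ^ q k))"
    by (simp only: norm_triangle_ineq4)
  also have "\<dots> \<le> cmod (V k) + c / 2 * cmod (deriv (deriv u) z)"
    using \<open>cmod (\<phi> z) < 1\<close> c(1)
    by (simp add: norm_mult norm_power mult_left_le power_le_one mult_left_mono)
  finally have "c / 2 * cmod (D (q k) z) \<le> cmod (V k) + c / 2 * cmod (deriv (deriv u) z)"
    using c(1) by (simp add: norm_mult)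
  then have "weight \<beta> z * (c / 2 * cmod (D (q k) z))
      \<le> weight \<beta> z * (cmod (V k) + c / 2 * cmod (deriv (deriv u) z))"
    by (rule mult_left_mono) simp
  then have "c * (weight \<beta> z * cmod (D (q k) z))
      \<le> 2 * (weight \<beta> z * cmod (V k)) + c * (weight \<beta> z * cmod (deriv (deriv u) z))"
    by (simp add: algebra_simps)
  also have "c * (weight \<beta> z * cmod (deriv (deriv u) z)) \<le> c * b"
    using b[OF z] c(1) by (rule mult_left_mono)
  finally show False
    using big Vk c(2) e unfolding c_def[symmetric] by linarith
qed

text \<open>If \<open>d n\<close> denotes the expression inside the norm, then \<open>a\<close> cancels in
  \<open>d (2 * n) - 2 * x ^ n * d n = 2 * n ^ 2 * b * x ^ (2 * n - 2)\<close>.\<close>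

lemma separate_coefficients:
  fixes a b x :: complex and w M \<alpha> :: real
  assumes \<alpha>: "0 < \<alpha>" "\<alpha> < 1" and x: "cmod x \<le> 1" and w: "0 \<le> w" and N: "0 < N"
    and D: "\<And>n. N \<le> n \<Longrightarrow> real n powr (\<alpha> - 1) *
      (w * cmod (of_nat n * a * x ^ (n - 1) + of_nat n * of_nat (n - 1) * b * x ^ (n - 2))) \<le> M"
  shows "2 * N \<le> m \<Longrightarrow> (real m + 1) powr (\<alpha> + 1) * (w * cmod (b * x ^ m)) \<le> 8 * M"
    and "2 * N + 1 \<le> m \<Longrightarrow> (real m + 1) powr \<alpha> * (w * cmod (a * x ^ m)) \<le> 33 * M"
proof -
  define d where "d = (\<lambda>n. of_nat n * a * x ^ (n - 1) + of_nat n * of_nat (n - 1) * b * x ^ (n - 2))"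
  have d: "w * cmod (d n) \<le> real n powr (1 - \<alpha>) * M" if "N \<le> n" for n
  proof -
    have "0 < real n" using N that by simp
    have "real n powr (1 - \<alpha>) * (real n powr (\<alpha> - 1) * (w * cmod (d n))) \<le> real n powr (1 - \<alpha>) * M"
      using D[OF that] unfolding d_def by (rule mult_left_mono) simp
    then show ?thesis
      using \<open>0 < real n\<close> by (simp add: mult.assoc[symmetric] powr_add[symmetric])
  qed
  have M: "0 \<le> M"
    using w by (intro order_trans[OF _ D[OF order_refl]]) simp
  \<comment> \<open>The terms at 2n and n contribute 2 powr (1 - alpha) + 2 <= 4 copies of n powr (1
    - alpha) * M; the factor 2 in the identity halves this.\<close>
  have B: "real n powr (\<alpha> + 1) * (w * cmod (b * x ^ (2 * n - 2))) \<le> 2 * M" if n: "N \<le> n" for n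
  proof -
    have n0: "0 < real n" "0 < n" using N n by auto
    have eq: "2 * (of_nat n)\<^sup>2 * (b * x ^ (2 * n - 2)) = d (2 * n) - 2 * x ^ n * d n"
    \<comment> \<open>For \<open>n = 1\<close> the exponent n - 2 is truncated to 0, so the generic
      identity with n = i + 2 does not apply.\<close>
    proof (cases "n = 1")
      case False
      then obtain i where i: "n = i + 2"
        using n0 by (metis add.commute add_2_eq_Suc not0_implies_Suc not_gr_zero One_nat_def)
      define p where "p = x ^ i"
      have p: "x ^ n = x\<^sup>2 * p" "x ^ (n - 1) = x * p" "x ^ (n - 2) = p"
        "x ^ (2 * n - 1) = x ^ 3 * p\<^sup>2" "x ^ (2 * n - 2) = x\<^sup>2 * p\<^sup>2"
        by (simp_all add: i p_def power_add power2_eq_square mult_2 eval_nat_numeral)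
      have r: "of_nat (n - 1) = (of_nat n - 1 :: complex)" "of_nat (2 * n - 1) = (2 * of_nat n - 1 :: complex)"
        using n0 by (simp_all add: of_nat_diff)
      show ?thesis
        unfolding d_def p r of_nat_mult of_nat_numeral by algebra
    qed (simp add: d_def numeral_2_eq_2)
    have "2 * (real n)\<^sup>2 * cmod (b * x ^ (2 * n - 2)) = cmod (2 * (of_nat n)\<^sup>2 * (b * x ^ (2 * n - 2)))"
      by (simp add: norm_mult norm_power)
    also have "\<dots> = cmod (d (2 * n) - 2 * x ^ n * d n)"
      by (simp only: eq)
    also have "\<dots> \<le> cmod (d (2 * n)) + 2 * (cmod x ^ n * cmod (d n))"
      using norm_triangle_ineq4[of "d (2 * n)" "2 * x ^ n * d n"] by (simp add: norm_mult norm_power)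
    also have "cmod x ^ n * cmod (d n) \<le> 1 * cmod (d n)"
      using x by (intro mult_right_mono power_le_one) auto
    finally have "w * (2 * (real n)\<^sup>2 * cmod (b * x ^ (2 * n - 2))) \<le> w * (cmod (d (2 * n)) + 2 * cmod (d n))"
      using w by (intro mult_left_mono) auto
    also have "\<dots> = w * cmod (d (2 * n)) + 2 * (w * cmod (d n))" by (simp add: algebra_simps)
    also have "\<dots> \<le> real (2 * n) powr (1 - \<alpha>) * M + 2 * (real n powr (1 - \<alpha>) * M)"
      using d[OF n] d[of "2 * n"] n by (intro add_mono mult_left_mono) auto
    also have "real (2 * n) powr (1 - \<alpha>) = 2 powr (1 - \<alpha>) * real n powr (1 - \<alpha>)"
      by (simp add: powr_mult)
    also have "2 powr (1 - \<alpha>) * real n powr (1 - \<alpha>) * M \<le> 2 powr 1 * real n powr (1 - \<alpha>) * M"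
      using \<alpha> M by (intro mult_right_mono powr_mono) auto
    finally have "2 * ((real n)\<^sup>2 * (w * cmod (b * x ^ (2 * n - 2)))) \<le> 4 * (real n powr (1 - \<alpha>) * M)"
      by (simp add: algebra_simps)
    then have "(real n)\<^sup>2 * (w * cmod (b * x ^ (2 * n - 2))) \<le> real n powr (1 - \<alpha>) * (2 * M)"
      by linarith
    then have "real n powr (\<alpha> - 1) * (real n powr 2 * (w * cmod (b * x ^ (2 * n - 2))))
        \<le> real n powr (\<alpha> - 1) * (real n powr (1 - \<alpha>) * (2 * M))"
      using n0 by (intro mult_left_mono) auto
    then show ?thesis
      using n0 by (simp add: mult.assoc[symmetric] powr_add[symmetric] del: powr_numeral) (simp add: add.commute)
  qed
  have two: "(2::real) powr (\<alpha> + 1) \<le> 4"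
    using powr_mono[of "\<alpha> + 1" 2 "2::real"] \<alpha> by simp
  have B': "(real m + 1) powr (\<alpha> + 1) * (w * cmod (b * x ^ m)) \<le> 8 * M" if m: "2 * N \<le> m" for m
  proof -
    \<comment> \<open>Then 2 * n - 2 is the largest even number below or equal to \<open>m\<close>.
      Powers of |x| decrease, so the even case dominates; replacing m + 1 by 2 * n costs 2 powr
      (alpha + 1) <= 4, and 4 * 2 = 8.\<close>
    define n where "n = m div 2 + 1"
    have n: "N \<le> n" "2 * n - 2 \<le> m" "m + 1 \<le> 2 * n" using m by (auto simp: n_def)
    have "(real m + 1) powr (\<alpha> + 1) \<le> (2 * real n) powr (\<alpha> + 1)"
      using n(3) \<alpha> by (intro powr_mono2) auto
    also have "\<dots> \<le> 4 * real n powr (\<alpha> + 1)"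
      using two by (simp add: powr_mult mult_right_mono)
    finally have 1: "(real m + 1) powr (\<alpha> + 1) \<le> 4 * real n powr (\<alpha> + 1)" .
    have 2: "w * cmod (b * x ^ m) \<le> w * cmod (b * x ^ (2 * n - 2))"
      unfolding norm_mult norm_power using w x n(2)
      by (intro mult_left_mono power_decreasing) auto
    have "(real m + 1) powr (\<alpha> + 1) * (w * cmod (b * x ^ m))
        \<le> 4 * real n powr (\<alpha> + 1) * (w * cmod (b * x ^ (2 * n - 2)))"
      by (rule mult_mono[OF 1 2]) (use w in auto)
    with B[OF n(1)] show ?thesis by simp
  qed
  then show "2 * N \<le> m \<Longrightarrow> (real m + 1) powr (\<alpha> + 1) * (w * cmod (b * x ^ m)) \<le> 8 * M" .
  assume m: "2 * N + 1 \<le> m"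
  \<comment> \<open>This turns x^(n-1) into x^m. The B term, already bounded, is subtracted: passing
    from the index n to n - 2 costs again a factor 4, so it contributes 4 * 8 = 32, and the full
    expression adds 1.\<close>
  define n where "n = m + 1"
  have n: "N \<le> n" "2 * N \<le> n - 2" "2 \<le> n" using m by (auto simp: n_def)
  have nr: "0 < real n" using n by simp
  have "real n powr (\<alpha> + 1) \<le> (2 * (real (n - 2) + 1)) powr (\<alpha> + 1)"
    using n(3) \<alpha> by (intro powr_mono2) auto
  also have "\<dots> \<le> 4 * (real (n - 2) + 1) powr (\<alpha> + 1)"
    using two by (subst powr_mult) (auto intro!: mult_right_mono)
  finally have "real n powr (\<alpha> + 1) * (w * cmod (b * x ^ (n - 2)))
      \<le> 4 * (real (n - 2) + 1) powr (\<alpha> + 1) * (w * cmod (b * x ^ (n - 2)))"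
    using w by (intro mult_right_mono) auto
  also have "\<dots> \<le> 4 * (8 * M)"
    using B'[OF n(2)] unfolding mult.assoc by (intro mult_left_mono) simp_all
  finally have b32: "real n powr (\<alpha> + 1) * (w * cmod (b * x ^ (n - 2))) \<le> 32 * M" by simp
  have "of_nat n * a * x ^ (n - 1) = d n - of_nat n * of_nat (n - 1) * b * x ^ (n - 2)"
    by (simp add: d_def)
  then have "cmod (of_nat n * a * x ^ (n - 1))
      \<le> cmod (d n) + cmod (of_nat n * of_nat (n - 1) * b * x ^ (n - 2))"
    by (simp only: norm_triangle_ineq4)
  then have "real n * cmod (a * x ^ m)
      \<le> cmod (d n) + real n * real (n - 1) * cmod (b * x ^ (n - 2))"
    unfolding norm_mult norm_of_nat by (simp add: mult.assoc n_def del: of_nat_Suc of_nat_add)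
  also have "real n * real (n - 1) * cmod (b * x ^ (n - 2)) \<le> real n * real n * cmod (b * x ^ (n - 2))"
    by (intro mult_right_mono mult_left_mono) auto
  finally have "(real n powr (\<alpha> - 1) * w) * (real n * cmod (a * x ^ m))
      \<le> (real n powr (\<alpha> - 1) * w) * (cmod (d n) + real n * real n * cmod (b * x ^ (n - 2)))"
    using w by (intro mult_left_mono) auto
  also have "\<dots> = real n powr (\<alpha> - 1) * (w * cmod (d n))
      + (real n powr (\<alpha> - 1) * (real n * real n)) * (w * cmod (b * x ^ (n - 2)))"
    by (simp add: algebra_simps)
  also have "real n powr (\<alpha> - 1) * (real n * real n) = real n powr (\<alpha> + 1)"
    using nr by (simp add: powr_add powr_diff)
  also have "real n powr (\<alpha> - 1) * (w * cmod (d n)) \<le> M"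
    using D[OF n(1)] by (simp add: d_def)
  finally have "(real n powr (\<alpha> - 1) * real n) * (w * cmod (a * x ^ m)) \<le> 33 * M"
    using b32 by (simp add: algebra_simps)
  moreover have "real n powr (\<alpha> - 1) * real n = (real m + 1) powr \<alpha>"
    using nr by (simp add: powr_diff n_def add.commute)
  ultimately show "(real m + 1) powr \<alpha> * (w * cmod (a * x ^ m)) \<le> 33 * M" by simp
qed

section \<open>Dilations of Bloch functions and growth of derivatives\<close>

text \<open>On the segment from r z to z one has |f'(s z)| <= (1 - s)^(-alpha), since 1 - |s z|^2 >=
  1 - s. Integrating over s from r to 1 gives the bound, independent of z and of f; convergence at s
  = 1 is where alpha < 1 enters.\<close>

lemma norm_diff_dilation_le:
  assumes \<alpha>: "0 < \<alpha>" "\<alpha> < 1" and f: "f \<in> bloch_space \<alpha>" "bloch_norm \<alpha> f \<le> 1"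
    and r: "0 \<le> r" "r < 1" and z: "z \<in> udisk"
  shows "cmod (f z - f (of_real r * z)) \<le> (1 - r) powr (1 - \<alpha>) / (1 - \<alpha>)"
proof -
  \<comment> \<open>An antiderivative of (1 - s) powr (- alpha), continuous up to s = 1 with value 0
    there.\<close>
  define p where "p = (\<lambda>s::real. - ((1 - s) powr (1 - \<alpha>) / (1 - \<alpha>)))"
  have holf: "f holomorphic_on udisk" using f by (simp add: bloch_space_def)
  have in_disk: "of_real s * z \<in> udisk" if "0 \<le> s" "s \<le> 1" for s
    using z that mult_left_le_one_le[of "cmod z" s] by (simp add: norm_mult)
  have D: "((\<lambda>s. f (of_real s * z)) has_vector_derivative deriv f (of_real s * z) * z) (at s within S)"
    if "0 \<le> s" "s \<le> 1" for s S
  proof -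
    have "(f has_field_derivative deriv f (of_real s * z)) (at (of_real s * z))"
      by (rule holomorphic_derivI[OF holf open_ball in_disk[OF that]])
    then have "((\<lambda>w. f (w * z)) has_field_derivative deriv f (of_real s * z) * z) (at (of_real s))"
      by (rule DERIV_chain2) (auto intro!: derivative_eq_intros)
    then have "((\<lambda>s. f (of_real s * z)) has_vector_derivative deriv f (of_real s * z) * z) (at s)"
      by (rule has_vector_derivative_real_field)
    then show ?thesis by (rule has_vector_derivative_at_within)
  qed
  have "norm (f (of_real 1 * z) - f (of_real r * z)) \<le> p 1 - p r"
  proof (rule differentiable_bound_general[OF r(2)])
    show "continuous_on {r..1} (\<lambda>s. f (of_real s * z))"
      using D r by (intro continuous_on_vector_derivative[OF D]) auto
    show "continuous_on {r..1} p"
      unfolding p_def using \<alpha> by (intro continuous_intros continuous_on_powr') auto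
    fix s :: real assume s: "r < s" "s < 1"
    show "((\<lambda>s. f (of_real s * z)) has_vector_derivative deriv f (of_real s * z) * z) (at s)"
      using D s r by auto
    show "(p has_vector_derivative (1 - s) powr (- \<alpha>)) (at s)"
      unfolding p_def has_real_derivative_iff_has_vector_derivative[symmetric]
      using s \<alpha> by (auto intro!: derivative_eq_intros)
    have "1 - s \<le> 1 - (cmod (of_real s * z))\<^sup>2"
    proof -
      have "(s * cmod z)\<^sup>2 \<le> s * cmod z"
        using s r z by (simp add: power2_eq_square mult_left_le mult_le_one)
      also have "\<dots> \<le> s" using s r z by (simp add: mult_left_le)
      finally show ?thesis using s r by (simp add: norm_mult)
    qed
    then have "(1 - s) powr \<alpha> \<le> weight \<alpha> (of_real s * z)"
      using s \<alpha> by (intro powr_mono2) auto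
    then have "(1 - s) powr \<alpha> * cmod (deriv f (of_real s * z)) \<le> 1"
      using bloch_norm_ge[OF f(1) in_disk[of s]] s r f(2)
      by (smt (verit) mult_right_mono norm_ge_zero)
    then have "cmod (deriv f (of_real s * z)) \<le> (1 - s) powr (- \<alpha>)"
      using s by (simp add: powr_minus field_simps)
    moreover have "cmod (deriv f (of_real s * z) * z) \<le> cmod (deriv f (of_real s * z))"
      using z by (simp add: norm_mult mult_left_le)
    ultimately show "norm (deriv f (of_real s * z) * z) \<le> (1 - s) powr (- \<alpha>)" by simp
  qed
  then show ?thesis by (simp add: p_def)
qed

text \<open>The dilation with r = 0 compares f with the constant f 0. The resulting uniform bound
  provides the normal family needed for compactness.\<close>

lemma norm_le_bloch:
  assumes \<alpha>: "0 < \<alpha>" "\<alpha> < 1" and f: "f \<in> bloch_space \<alpha>" "bloch_norm \<alpha> f \<le> 1"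
    and z: "z \<in> udisk"
  shows "cmod (f z) \<le> 1 + 1 / (1 - \<alpha>)"
proof -
  have "cmod (f z - f 0) \<le> 1 / (1 - \<alpha>)"
    using norm_diff_dilation_le[OF \<alpha> f _ _ z, of 0] by simp
  moreover have "cmod (f 0) \<le> 1"
    using norm_0_le_bloch_norm[OF f(1)] f(2) by simp
  moreover have "cmod (f z) \<le> cmod (f z - f 0) + cmod (f 0)"
    using norm_triangle_ineq[of "f z - f 0" "f 0"] by simp
  ultimately show ?thesis by simp
qed

lemma dilation_in_udisk:
  assumes "0 \<le> r" "r \<le> 1" "z \<in> udisk"
  shows "of_real r * z \<in> udisk"
  using assms mult_left_le_one_le[of "cmod z" r] by (simp add: norm_mult)

lemma
  assumes f: "f holomorphic_on udisk" and r: "0 \<le> r" "r \<le> 1"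
  shows holomorphic_dilation: "(\<lambda>z. f (of_real r * z)) holomorphic_on udisk"
    and deriv_dilation: "z \<in> udisk \<Longrightarrow>
      deriv (\<lambda>z. f (of_real r * z)) z = of_real r * deriv f (of_real r * z)"
    and deriv2_dilation: "z \<in> udisk \<Longrightarrow>
      deriv (deriv (\<lambda>z. f (of_real r * z))) z = (of_real r)\<^sup>2 * deriv (deriv f) (of_real r * z)"
proof -
  have D: "((\<lambda>z. g (of_real r * z)) has_field_derivative of_real r * deriv g (of_real r * z)) (at z)"
    if "g holomorphic_on udisk" "z \<in> udisk" for g z
  proof -
    have "(g has_field_derivative deriv g (of_real r * z)) (at (of_real r * z))"
      using that r by (intro holomorphic_derivI[of _ udisk] dilation_in_udisk) auto
    then have "((\<lambda>z. g (of_real r * z)) has_field_derivative deriv g (of_real r * z) * of_real r) (at z)"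
      by (rule DERIV_chain2) (auto intro!: derivative_eq_intros)
    then show ?thesis by (simp add: mult.commute)
  qed
  show "(\<lambda>z. f (of_real r * z)) holomorphic_on udisk"
    unfolding holomorphic_on_open[OF open_ball] using D[OF f] by blast
  have d1: "deriv (\<lambda>z. f (of_real r * z)) z = of_real r * deriv f (of_real r * z)" if "z \<in> udisk" for z
    using D[OF f that] by (rule DERIV_imp_deriv)
  then show "z \<in> udisk \<Longrightarrow> deriv (\<lambda>z. f (of_real r * z)) z = of_real r * deriv f (of_real r * z)" .
  assume z: "z \<in> udisk"
  have "deriv (deriv (\<lambda>z. f (of_real r * z))) z = deriv (\<lambda>z. of_real r * deriv f (of_real r * z)) z"
    using d1 z by (rule deriv_cong_udisk)
  also have "\<dots> = of_real r * (of_real r * deriv (deriv f) (of_real r * z))"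
    by (rule DERIV_imp_deriv) (intro DERIV_cmult D holomorphic_deriv f open_ball z)
  finally show "deriv (deriv (\<lambda>z. f (of_real r * z))) z = (of_real r)\<^sup>2 * deriv (deriv f) (of_real r * z)"
    by (simp add: power2_eq_square)
qed

lemma weight_dilation_mono:
  assumes "0 \<le> \<alpha>" "0 \<le> r" "r \<le> 1" "z \<in> udisk"
  shows "weight \<alpha> z \<le> weight \<alpha> (of_real r * z)"
proof -
  have "(r * cmod z)\<^sup>2 \<le> (cmod z)\<^sup>2"
    using assms by (intro power_mono) (auto simp: mult_left_le_one_le)
  moreover have "(cmod z)\<^sup>2 \<le> 1" using assms by (simp add: power_le_one)
  ultimately show ?thesis
    using assms by (intro powr_mono2) (auto simp: norm_mult)
qed

text \<open>The weight decreases radially, so dilating cannot increase the weighted derivative; the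
  bound is therefore uniform in r.\<close>

lemma dilation_deriv_le:
  assumes "f \<in> bloch_space \<alpha>" "0 \<le> \<alpha>" "0 \<le> r" "r \<le> 1" "z \<in> udisk"
  shows "weight \<alpha> z * cmod (deriv (\<lambda>z. f (of_real r * z)) z) \<le> bloch_norm \<alpha> f"
proof -
  have holf: "f holomorphic_on udisk" using assms by (simp add: bloch_space_def)
  have "weight \<alpha> z * cmod (deriv (\<lambda>z. f (of_real r * z)) z)
      = r * (weight \<alpha> z * cmod (deriv f (of_real r * z)))"
    using deriv_dilation[OF holf assms(3-5)] assms(3) by (simp add: norm_mult)
  also have "\<dots> \<le> 1 * (weight \<alpha> z * cmod (deriv f (of_real r * z)))"
    using assms by (intro mult_right_mono) auto
  also have "\<dots> \<le> weight \<alpha> (of_real r * z) * cmod (deriv f (of_real r * z))"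
    using weight_dilation_mono[OF assms(2-5)] by (simp add: mult_right_mono)
  also have "\<dots> \<le> bloch_norm \<alpha> f"
    using assms by (intro bloch_norm_ge dilation_in_udisk) auto
  finally show ?thesis .
qed

lemma dilation_in_bloch:
  assumes "f \<in> bloch_space \<alpha>" "0 \<le> \<alpha>" "0 \<le> r" "r \<le> 1"
  shows "(\<lambda>z. f (of_real r * z)) \<in> bloch_space \<alpha>"
proof (rule bloch_spaceI)
  show "(\<lambda>z. f (of_real r * z)) holomorphic_on udisk"
    using assms by (intro holomorphic_dilation) (auto simp: bloch_space_def)
qed (rule dilation_deriv_le[OF assms])

text \<open>Cauchy's estimate on the circle of radius d, half the distance to the boundary. On it 1
  - |x|^2 is at least a quarter of 1 - |z|^2, which costs 4 powr a <= 4, and 1 / d <= 4 / (1 -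
  |z|^2) supplies the other factor 4.\<close>

lemma deriv_growth:
  assumes h: "h holomorphic_on udisk" and a: "0 \<le> a" "a \<le> 1" and c: "0 \<le> c"
    and le: "\<And>x. x \<in> udisk \<Longrightarrow> cmod (h x) \<le> c * weight (- a) x" and z: "z \<in> udisk"
  shows "cmod (deriv h z) \<le> 16 * c * weight (- (a + 1)) z"
proof -
  define q where "q = 1 - (cmod z)\<^sup>2"
  define d where "d = (1 - cmod z) / 2"
  have "q = (1 + cmod z) * (1 - cmod z)" by (simp add: q_def power2_eq_square algebra_simps)
  moreover have "(1 + cmod z) * (1 - cmod z) \<le> 2 * (1 - cmod z)"
    using z by (intro mult_right_mono) auto
  ultimately have q: "q \<le> 4 * d" by (simp add: d_def)
  have d: "0 < d" "cmod z + d < 1" using z by (auto simp: d_def field_simps)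
  have q0: "0 < q" using z power_strict_mono[of "cmod z" 1 2] by (simp add: q_def)
  have "cmod (deriv h z) \<le> (c * (4 * q powr (- a))) / d"
  proof (rule norm_deriv_le_Cauchy[OF h d])
    fix x assume x: "cmod (z - x) = d"
    have "cmod x \<le> cmod z + d"
      using x norm_triangle_ineq4[of z "z - x"] by simp
    then have x1: "cmod x \<le> 1 - d" by (simp add: d_def field_simps)
    then have xin: "x \<in> udisk" using d by simp
    have "(cmod x)\<^sup>2 \<le> cmod x" using xin by (simp add: power2_eq_square mult_left_le)
    with x1 q have "q / 4 \<le> 1 - (cmod x)\<^sup>2" by simp
    then have "weight (- a) x \<le> (q / 4) powr (- a)"
      using q0 a by (intro powr_mono2') auto
    also have "\<dots> = 4 powr a * q powr (- a)"
      using q0 by (simp add: powr_divide powr_minus field_simps)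
    also have "\<dots> \<le> 4 powr 1 * q powr (- a)"
      using a by (intro mult_right_mono powr_mono) auto
    finally have "c * weight (- a) x \<le> c * (4 * q powr (- a))"
      using c by (intro mult_left_mono) auto
    with le[OF xin] show "cmod (h x) \<le> c * (4 * q powr (- a))" by simp
  qed
  also have "\<dots> = 4 * c * q powr (- a) * (1 / d)" by simp
  also have "\<dots> \<le> 4 * c * q powr (- a) * (4 / q)"
    using q q0 d c by (intro mult_left_mono) (auto simp: field_simps)
  also have "\<dots> = 16 * c * q powr (- (a + 1))"
    using q0 by (simp add: powr_diff)
  finally show ?thesis by (simp add: q_def)
qed

text \<open>With d a quarter of 1 - rho, the second derivative uses a circle of radius 2 d and then
  circles of radius d, all inside the disc. This gives delta / (2 d^2), which is the stated
  constant; the bound delta / d for the first derivative is smaller because 2 d <= 1.\<close>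

lemma
  assumes g: "g holomorphic_on udisk" and le: "\<And>x. x \<in> udisk \<Longrightarrow> cmod (g x) \<le> \<delta>"
    and \<rho>: "cmod z \<le> \<rho>" "\<rho> < 1"
  shows bounded_deriv_le: "cmod (deriv g z) \<le> 8 * \<delta> / (1 - \<rho>)\<^sup>2"
    and bounded_deriv2_le: "cmod (deriv (deriv g) z) \<le> 8 * \<delta> / (1 - \<rho>)\<^sup>2"
proof -
  define d where "d = (1 - \<rho>) / 4"
  have d: "0 < d" "\<rho> + 3 * d < 1" "d \<le> 1 / 4"
    using \<rho> norm_ge_zero[of z] unfolding d_def by (auto simp: field_simps simp del: norm_ge_zero)
  have \<delta>: "0 \<le> \<delta>" using le[of 0] norm_ge_zero[of "g 0"] by (simp del: norm_ge_zero)
  have in_disk: "x \<in> udisk" if "cmod (w - x) = s" "cmod w + s < 1" for w x s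
    using that norm_triangle_ineq4[of w "w - x"] by simp
  have g1: "cmod (deriv g w) \<le> \<delta> / d" if "cmod w \<le> \<rho> + 2 * d" for w
    using g d that by (intro norm_deriv_le_Cauchy[where d = d] le in_disk[of w _ d]) auto
  have g2: "cmod (deriv (deriv g) z) \<le> (\<delta> / d) / (2 * d)"
  proof (rule norm_deriv_le_Cauchy)
    show "deriv g holomorphic_on udisk" using g by (intro holomorphic_deriv) auto
    fix x assume "cmod (z - x) = 2 * d"
    then show "cmod (deriv g x) \<le> \<delta> / d"
      using norm_triangle_ineq4[of z "z - x"] \<rho> by (intro g1) simp
  qed (use d \<rho> in auto)
  have eq: "(\<delta> / d) / (2 * d) = 8 * \<delta> / (1 - \<rho>)\<^sup>2"
  proof -
    have "1 - \<rho> = 4 * d" by (simp add: d_def)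
    then show ?thesis by (simp add: power2_eq_square)
  qed
  then show "cmod (deriv (deriv g) z) \<le> 8 * \<delta> / (1 - \<rho>)\<^sup>2" using g2 by simp
  have "\<delta> / d \<le> (\<delta> / d) / (2 * d)"
    using \<delta> d by (simp add: le_divide_eq mult_left_le)
  then show "cmod (deriv g z) \<le> 8 * \<delta> / (1 - \<rho>)\<^sup>2"
    using g1[of z] \<rho> d eq by simp
qed

section \<open>Compactness of the dilated operators\<close>

lemma zyg_norm_wcomp_le_uniform:
  assumes u: "u holomorphic_on udisk" and \<phi>: "\<phi> \<in> self_maps" and h: "h holomorphic_on udisk"
    and b: "\<And>z. z \<in> udisk \<Longrightarrow> weight \<beta> z * cmod (deriv (deriv u) z) \<le> b"
      "\<And>z. z \<in> udisk \<Longrightarrow>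
        weight \<beta> z * cmod (2 * deriv u z * deriv \<phi> z + u z * deriv (deriv \<phi>) z) \<le> b"
      "\<And>z. z \<in> udisk \<Longrightarrow> weight \<beta> z * cmod (u z * (deriv \<phi> z)\<^sup>2) \<le> b"
    and d: "\<And>z. z \<in> udisk \<Longrightarrow> cmod (h z) \<le> d" "\<And>z. z \<in> udisk \<Longrightarrow> cmod (deriv h z) \<le> d"
      "\<And>z. z \<in> udisk \<Longrightarrow> cmod (deriv (deriv h) z) \<le> d"
  shows "zyg_norm \<beta> (wcomp u \<phi> h)
    \<le> (cmod (u 0) + cmod (deriv u 0) + cmod (u 0) * cmod (deriv \<phi> 0) + 3 * b) * d"
proof -
  have b0: "0 \<le> b" using b(1)[of 0] by (rule order_trans[rotated]) auto
  have "zyg_norm \<beta> (wcomp u \<phi> h)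
    \<le> (cmod (u 0) + cmod (deriv u 0) + cmod (u 0) * cmod (deriv \<phi> 0)) * d + (b * d + b * d + b * d)"
    using self_maps_in_udisk[OF \<phi>] b0
    by (intro zyg_norm_wcomp_le[OF u \<phi> h] add_mono mult_mono b d) auto
  then show ?thesis by (simp add: algebra_simps)
qed

text \<open>By Montel a subsequence of a sequence in the unit ball converges uniformly on compact
  subsets. The dilation pulls the disc into a compact subset, where Cauchy's estimates make the
  first two derivatives of the difference small as well.\<close>

lemma cpt_wop_wcomp_dilation:
  assumes \<alpha>: "0 < \<alpha>" "\<alpha> < 1" and u: "u holomorphic_on udisk" and \<phi>: "\<phi> \<in> self_maps"
    and maps: "\<And>f. f \<in> bloch_space \<alpha> \<Longrightarrow> wcomp u \<phi> f \<in> zyg_space \<beta>"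
    and r: "0 < r" "r < 1"
  shows "cpt_wop (bloch_space \<alpha>) (bloch_norm \<alpha>) (zyg_space \<beta>) (zyg_norm \<beta>)
    (\<lambda>f. wcomp u \<phi> (\<lambda>z. f (of_real r * z)))"
  unfolding cpt_wop_def
proof (intro conjI allI impI)
  show "linear_op_on (bloch_space \<alpha>) (zyg_space \<beta>) (\<lambda>f. wcomp u \<phi> (\<lambda>z. f (of_real r * z)))"
    unfolding linear_op_on_def
  proof (intro conjI ballI allI)
    show "wcomp u \<phi> (\<lambda>z. f (of_real r * z)) \<in> zyg_space \<beta>" if "f \<in> bloch_space \<alpha>" for f
      using that \<alpha> r by (intro maps dilation_in_bloch) auto
  qed (simp add: wcomp_def algebra_simps)
  fix s :: "nat \<Rightarrow> complex \<Rightarrow> complex"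
  assume s: "\<forall>n. s n \<in> bloch_space \<alpha> \<and> bloch_norm \<alpha> (s n) \<le> 1"
  define B where "B = 1 + 1 / (1 - \<alpha>)"
  have sB: "cmod (s n z) \<le> B" if "z \<in> udisk" for n z
    unfolding B_def using s that by (intro norm_le_bloch[OF \<alpha>]) auto
  have hols: "s n holomorphic_on udisk" for n using s by (simp add: bloch_space_def)
  obtain g k where holg: "g holomorphic_on udisk" and k: "strict_mono (k :: nat \<Rightarrow> nat)"
    and lim: "\<And>x. x \<in> udisk \<Longrightarrow> (\<lambda>n. s (k n) x) \<longlonglongrightarrow> g x"
    and unif: "\<And>K. compact K \<Longrightarrow> K \<subseteq> udisk \<Longrightarrow> uniform_limit K (s \<circ> k) g sequentially"
  proof (rule Montel[of udisk "range s" s])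
    show "\<exists>B. \<forall>h\<in>range s. \<forall>z\<in>K. cmod (h z) \<le> B" if "compact K" "K \<subseteq> udisk" for K
      using that sB by blast
  qed (use hols that in auto)
  have gB: "cmod (g z) \<le> B" if "z \<in> udisk" for z
    using tendsto_norm[OF lim[OF that]] sB[OF that] by (intro LIMSEQ_le_const2) auto
  let ?G = "wcomp u \<phi> (\<lambda>z. g (of_real r * z))"
  \<comment> \<open>Only the dilated limit is shown to be in the Bloch type space; boundedness of
    \<open>g\<close> and Cauchy's estimate on |w| <= r are enough for that.\<close>
  have "(\<lambda>z. g (of_real r * z)) \<in> bloch_space \<alpha>"
  proof (rule bloch_spaceI)
    show "(\<lambda>z. g (of_real r * z)) holomorphic_on udisk"
      using holg r by (intro holomorphic_dilation) auto
    fix z :: complex assume z: "z \<in> udisk"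
    have "cmod (of_real r * z) \<le> r"
      using z r by (simp add: norm_mult mult_left_le)
    then have "cmod (deriv g (of_real r * z)) \<le> 8 * B / (1 - r)\<^sup>2"
      using r by (intro bounded_deriv_le[OF holg gB])
    then have "weight \<alpha> z * (r * cmod (deriv g (of_real r * z))) \<le> 1 * (1 * (8 * B / (1 - r)\<^sup>2))"
      using r \<alpha> z by (intro mult_mono weight_le_1) auto
    then show "weight \<alpha> z * cmod (deriv (\<lambda>z. g (of_real r * z)) z) \<le> 8 * B / (1 - r)\<^sup>2"
      using r deriv_dilation[OF holg _ _ z, of r] by (simp add: norm_mult)
  qed
  then have G: "?G \<in> zyg_space \<beta>" by (rule maps)
  obtain b where b: "0 < b"
      "\<And>z. z \<in> udisk \<Longrightarrow> weight \<beta> z * cmod (deriv (deriv u) z) \<le> b"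
      "\<And>z. z \<in> udisk \<Longrightarrow>
        weight \<beta> z * cmod (2 * deriv u z * deriv \<phi> z + u z * deriv (deriv \<phi>) z) \<le> b"
      "\<And>z. z \<in> udisk \<Longrightarrow> weight \<beta> z * cmod (u z * (deriv \<phi> z)\<^sup>2) \<le> b"
    by (rule wcomp_coefficients_bounded[OF u \<phi> less_imp_le[OF \<alpha>(1)] maps]) (assumption | rule that)+
  define C where "C = cmod (u 0) + cmod (deriv u 0) + cmod (u 0) * cmod (deriv \<phi> 0) + 3 * b"
  have C: "0 < C" using b(1) by (simp add: C_def add_nonneg_pos)
  \<comment> \<open>The dilation by r is split as r = p * sigma with both factors below 1: p gives
    smallness on the whole disc, and sigma leaves room for Cauchy's estimates.\<close>
  define p \<sigma> where "p = (1 + r) / 2" and "\<sigma> = r / p"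
  have p: "0 < p" "p < 1" and \<sigma>: "0 < \<sigma>" "\<sigma> < 1" and \<sigma>p: "p * \<sigma> = r"
    using r by (auto simp: p_def \<sigma>_def field_simps)
  have small: "zyg_norm \<beta> (\<lambda>z. wcomp u \<phi> (\<lambda>z. s n (of_real r * z)) z - ?G z)
      \<le> C * (8 * \<eta> / (1 - \<sigma>)\<^sup>2)"
    if \<eta>: "\<And>x. x \<in> cball 0 p \<Longrightarrow> cmod (s n x - g x) \<le> \<eta>" for n \<eta>
  proof -
    define F where "F = (\<lambda>x. s n x - g x)"
    define H where "H = (\<lambda>z. F (of_real p * z))"
    have holF: "F holomorphic_on udisk"
      unfolding F_def by (intro holomorphic_intros hols holg)
    then have holH: "H holomorphic_on udisk"
      unfolding H_def using p by (intro holomorphic_dilation) auto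
    have H: "cmod (H z) \<le> \<eta>" if "z \<in> udisk" for z
      unfolding H_def F_def using that p by (intro \<eta>) (auto simp: norm_mult mult_left_le)
    have \<eta>0: "0 \<le> \<eta>" using H[of 0] norm_ge_zero[of "H 0"] by (simp del: norm_ge_zero)
    define d where "d = 8 * \<eta> / (1 - \<sigma>)\<^sup>2"
    have "(1 - \<sigma>)\<^sup>2 \<le> 1" using \<sigma> by (intro power_le_one) auto
    then have "\<eta> * (1 - \<sigma>)\<^sup>2 \<le> 8 * \<eta>" using \<eta>0 mult_left_mono[of "(1 - \<sigma>)\<^sup>2" 1 \<eta>] by simp
    then have \<eta>d: "\<eta> \<le> d" using \<sigma> by (simp add: d_def field_simps)
    have H': "cmod (deriv H (of_real \<sigma> * z)) \<le> d" "cmod (deriv (deriv H) (of_real \<sigma> * z)) \<le> d"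
      if "z \<in> udisk" for z
    proof -
      have "cmod (of_real \<sigma> * z) \<le> \<sigma>" using that \<sigma> by (simp add: norm_mult mult_left_le)
      then show "cmod (deriv H (of_real \<sigma> * z)) \<le> d" "cmod (deriv (deriv H) (of_real \<sigma> * z)) \<le> d"
        unfolding d_def using \<sigma> by (intro bounded_deriv_le[OF holH H] bounded_deriv2_le[OF holH H]; simp)+
    qed
    have "zyg_norm \<beta> (wcomp u \<phi> (\<lambda>z. H (of_real \<sigma> * z))) \<le> C * d"
      unfolding C_def
    proof (rule zyg_norm_wcomp_le_uniform[OF u \<phi> _ b(2-4)])
      show "(\<lambda>z. H (of_real \<sigma> * z)) holomorphic_on udisk"
        using holH \<sigma> by (intro holomorphic_dilation) auto
      fix z :: complex assume z: "z \<in> udisk"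
      show "cmod (H (of_real \<sigma> * z)) \<le> d"
        using H[OF dilation_in_udisk[OF _ _ z, of \<sigma>]] \<sigma> \<eta>d by simp
      have "\<sigma> * cmod (deriv H (of_real \<sigma> * z)) \<le> 1 * d"
        using \<sigma> H'[OF z] by (intro mult_mono) auto
      then show "cmod (deriv (\<lambda>z. H (of_real \<sigma> * z)) z) \<le> d"
        using \<sigma> deriv_dilation[OF holH _ _ z, of \<sigma>] by (simp add: norm_mult)
      have "\<sigma>\<^sup>2 * cmod (deriv (deriv H) (of_real \<sigma> * z)) \<le> 1 * d"
        using \<sigma> H'[OF z] by (intro mult_mono power_le_one) auto
      then show "cmod (deriv (deriv (\<lambda>z. H (of_real \<sigma> * z))) z) \<le> d"
        using \<sigma> deriv2_dilation[OF holH _ _ z, of \<sigma>] by (simp add: norm_mult norm_power)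
    qed
    moreover have "wcomp u \<phi> (\<lambda>z. H (of_real \<sigma> * z))
        = (\<lambda>z. wcomp u \<phi> (\<lambda>z. s n (of_real r * z)) z - ?G z)"
      unfolding wcomp_def H_def F_def mult.assoc[symmetric] of_real_mult[symmetric] \<sigma>p
      by (simp add: algebra_simps)
    ultimately show ?thesis by (simp add: d_def)
  qed
  have "(\<lambda>n. zyg_norm \<beta> (\<lambda>z. wcomp u \<phi> (\<lambda>z. s (k n) (of_real r * z)) z - ?G z)) \<longlonglongrightarrow> 0"
  proof (rule LIMSEQ_I)
    fix e :: real assume e: "0 < e"
    \<comment> \<open>Chosen so that the bound from \<open>small\<close> equals e / 2.\<close>
    define \<eta> where "\<eta> = e * (1 - \<sigma>)\<^sup>2 / (16 * C)"
    have \<eta>: "0 < \<eta>" using e C \<sigma> by (simp add: \<eta>_def)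
    have "uniform_limit (cball 0 p) (s \<circ> k) g sequentially"
      using p by (intro unif) auto
    from uniform_limitD[OF this \<eta>] obtain N
      where N: "\<And>n x. n \<ge> N \<Longrightarrow> x \<in> cball 0 p \<Longrightarrow> cmod (s (k n) x - g x) \<le> \<eta>"
      unfolding eventually_sequentially dist_norm o_def by (meson less_imp_le)
    have "norm (zyg_norm \<beta> (\<lambda>z. wcomp u \<phi> (\<lambda>z. s (k n) (of_real r * z)) z - ?G z) - 0) < e"
      if n: "n \<ge> N" for n
    proof -
      have "(\<lambda>z. s (k n) (of_real r * z)) \<in> bloch_space \<alpha>"
        using s r \<alpha> by (intro dilation_in_bloch) auto
      from zyg_lincomb(1)[OF maps[OF this] G, of 1 "-1"]
      have "(\<lambda>z. wcomp u \<phi> (\<lambda>z. s (k n) (of_real r * z)) z - ?G z) \<in> zyg_space \<beta>" by simp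
      from zyg_norm_ge(2)[OF this]
      have "0 \<le> zyg_norm \<beta> (\<lambda>z. wcomp u \<phi> (\<lambda>z. s (k n) (of_real r * z)) z - ?G z)" .
      moreover have "zyg_norm \<beta> (\<lambda>z. wcomp u \<phi> (\<lambda>z. s (k n) (of_real r * z)) z - ?G z)
          \<le> C * (8 * \<eta> / (1 - \<sigma>)\<^sup>2)"
        by (rule small) (rule N[OF n])
      moreover have "C * (8 * \<eta> / (1 - \<sigma>)\<^sup>2) = e / 2"
        using C \<sigma> by (simp add: \<eta>_def)
      ultimately show ?thesis using e by simp
    qed
    then show "\<exists>N. \<forall>n\<ge>N. norm (zyg_norm \<beta>
        (\<lambda>z. wcomp u \<phi> (\<lambda>z. s (k n) (of_real r * z)) z - ?G z) - 0) < e" by blast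
  qed
  with k G show "\<exists>(k :: nat \<Rightarrow> nat) g. strict_mono k \<and> g \<in> zyg_space \<beta> \<and>
      (\<lambda>n. zyg_norm \<beta> (\<lambda>z. wcomp u \<phi> (\<lambda>z. s (k n) (of_real r * z)) z - g z)) \<longlonglongrightarrow> 0"
    by blast
qed

section \<open>Upper estimate through dilations\<close>

text \<open>For \<^term>\<open>t\<close> close to 1 the hypothesis is used with \<^term>\<open>n + 1 = \<lfloor>1 / (1 - t)\<rfloor>\<close>,
  where \<^term>\<open>t ^ n\<close> is at least \<^term>\<open>exp (- 1)\<close>.\<close>

lemma le_powr_of_power_bounds:
  fixes t x M a :: real
  assumes a: "0 \<le> a" "a \<le> 2" and x: "0 \<le> x" and t: "1 - 1 / (real N + 2) \<le> t" "t < 1"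
    and le: "\<And>n. N \<le> n \<Longrightarrow> (real n + 1) powr a * (x * t ^ n) \<le> M"
  shows "x \<le> 12 * M * (1 - t\<^sup>2) powr a"
proof -
  define j where "j = \<lfloor>1 / (1 - t)\<rfloor>"
  define n where "n = nat j - 1"
  have "1 - t \<le> 1 / (real N + 2)" using t by simp
  then have "real N + 2 \<le> 1 / (1 - t)" using t by (simp add: field_simps)
  then have "int N + 2 \<le> j" by (simp add: le_floor_iff j_def)
  then have n: "N + 1 \<le> n" and j: "j = int n + 1" by (auto simp: n_def)
  have n1: "real n + 1 \<le> 1 / (1 - t)" and n2: "1 / (1 - t) < real n + 2"
    using j unfolding j_def by linarith+
  have t0: "0 < t"
  proof -
    have "1 / (real N + 2) < 1" by simp
    with t show ?thesis by linarith
  qed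
  \<comment> \<open>This says t >= n / (n + 1), so (1/t)^n <= (1 + 1/n)^n <= e; the proof continues
    with 3 in place of e.\<close>
  have "(real n + 1) * (1 - t) \<le> 1" using n1 t by (simp add: field_simps)
  then have "real n \<le> t * (real n + 1)" by (simp add: algebra_simps)
  then have "1 / t \<le> 1 + 1 / real n"
    using n t0 by (simp add: field_simps)
  then have "(1 / t) ^ n \<le> (1 + 1 / real n) ^ n"
    using t0 by (intro power_mono) auto
  also have "\<dots> \<le> exp 1"
    using n by (intro exp_ge_one_plus_x_over_n_power_n) auto
  also have "\<dots> \<le> 3" by (rule exp_le)
  finally have tn: "1 \<le> 3 * t ^ n"
    using t0 by (simp add: power_one_over field_simps)
  \<comment> \<open>Rounding down loses at most a factor 2 in n + 1. Its power is 2 powr a <= 4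
    because a <= 2, and with the 3 above this makes 12.\<close>
  have "1 / (2 * (1 - t)) = 1 / (1 - t) / 2" by simp
  also have "\<dots> \<le> (real n + 2) / 2" using n2 by (intro divide_right_mono) auto
  also have "\<dots> \<le> real n + 1" by simp
  finally have "1 / (2 * (1 - t)) \<le> real n + 1" .
  moreover have "1 - t \<le> 1 - t\<^sup>2"
    using t t0 by (simp add: power2_eq_square mult_left_le)
  moreover from this have "1 / (2 * (1 - t\<^sup>2)) \<le> 1 / (2 * (1 - t))"
    using t by (intro divide_left_mono) auto
  ultimately have q: "1 / (2 * (1 - t\<^sup>2)) \<le> real n + 1" "0 < 1 - t\<^sup>2" using t by linarith+
  have "1 / (4 * (1 - t\<^sup>2) powr a) \<le> 1 / (2 powr a * (1 - t\<^sup>2) powr a)"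
    using q powr_mono[of a 2 "2 :: real"] a by (intro divide_left_mono mult_right_mono) auto
  also have "\<dots> = (1 / (2 * (1 - t\<^sup>2))) powr a"
    by (simp only: powr_divide powr_mult powr_one_eq_one)
  also have "\<dots> \<le> (real n + 1) powr a"
    using q a by (intro powr_mono2) auto
  finally have "1 / (4 * (1 - t\<^sup>2) powr a) * (x * t ^ n) \<le> (real n + 1) powr a * (x * t ^ n)"
    using x t0 by (intro mult_right_mono) auto
  also have "\<dots> \<le> M" using n by (intro le) simp
  finally have "x * t ^ n \<le> 4 * M * (1 - t\<^sup>2) powr a"
    using q by (simp add: field_simps)
  moreover have "x * 1 \<le> x * (3 * t ^ n)"
    using x tn by (intro mult_left_mono) auto
  ultimately show ?thesis by simp
qed

text \<open>The number r is fixed before f, so the estimate is uniform on the unit ball. Near the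
  boundary the weights of A and B cancel the growth of g' and g'', where g is f minus its dilation;
  this gives 34 = 2 + 32. Everything else is absorbed into e through the uniform smallness of
  g.\<close>

lemma wcomp_dilation_diff_bound:
  assumes \<alpha>: "0 < \<alpha>" "\<alpha> < 1" and u: "u holomorphic_on udisk" and \<phi>: "\<phi> \<in> self_maps"
    and maps: "\<And>f. f \<in> bloch_space \<alpha> \<Longrightarrow> wcomp u \<phi> f \<in> zyg_space \<beta>"
    and e: "0 < e" and M: "0 \<le> M" and \<rho>: "\<rho> < 1"
    and A: "\<And>z. z \<in> udisk \<Longrightarrow> \<rho> \<le> cmod (\<phi> z) \<Longrightarrow>
      weight \<beta> z * cmod (2 * deriv u z * deriv \<phi> z + u z * deriv (deriv \<phi>) z)
      \<le> M * weight \<alpha> (\<phi> z)"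
    and B: "\<And>z. z \<in> udisk \<Longrightarrow> \<rho> \<le> cmod (\<phi> z) \<Longrightarrow>
      weight \<beta> z * cmod (u z * (deriv \<phi> z)\<^sup>2) \<le> M * weight (\<alpha> + 1) (\<phi> z)"
  obtains r where "0 < r" "r < 1"
    and "\<And>f. f \<in> bloch_space \<alpha> \<Longrightarrow> bloch_norm \<alpha> f \<le> 1 \<Longrightarrow>
      zyg_norm \<beta> (wcomp u \<phi> (\<lambda>z. f z - f (of_real r * z))) \<le> 34 * M + e"
proof -
  obtain b where b: "0 < b"
      "\<And>z. z \<in> udisk \<Longrightarrow> weight \<beta> z * cmod (deriv (deriv u) z) \<le> b"
      "\<And>z. z \<in> udisk \<Longrightarrow>
        weight \<beta> z * cmod (2 * deriv u z * deriv \<phi> z + u z * deriv (deriv \<phi>) z) \<le> b"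
      "\<And>z. z \<in> udisk \<Longrightarrow> weight \<beta> z * cmod (u z * (deriv \<phi> z)\<^sup>2) \<le> b"
    by (rule wcomp_coefficients_bounded[OF u \<phi> less_imp_le[OF \<alpha>(1)] maps]) (assumption | rule that)+
  define C where "C = cmod (u 0) + cmod (deriv u 0) + cmod (u 0) * cmod (deriv \<phi> 0) + 3 * b"
  have C: "0 < C" using b(1) by (simp add: C_def add_nonneg_pos)
  \<comment> \<open>Enlarged to contain |phi 0|, so that the local derivative bounds also cover the
    point evaluation in the norm.\<close>
  define \<rho>' where "\<rho>' = max \<rho> (cmod (\<phi> 0))"
  have \<rho>': "0 \<le> \<rho>'" "\<rho>' < 1" "\<rho> \<le> \<rho>'" "cmod (\<phi> 0) \<le> \<rho>'"
    using \<rho> self_maps_in_udisk[OF \<phi>, of 0] by (auto simp: \<rho>'_def max.coboundedI2)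
  \<comment> \<open>Determined backwards from the requirement C * d = e.\<close>
  define \<eta> where "\<eta> = e * (1 - \<rho>')\<^sup>2 / (8 * C) * (1 - \<alpha>)"
  have \<eta>: "0 < \<eta>" using e C \<rho>' \<alpha> by (simp add: \<eta>_def)
  \<comment> \<open>The second entry makes s powr (1 - alpha) at most \<open>\<eta>\<close>; the
    first keeps r = 1 - s inside (0,1).\<close>
  define s where "s = min (1 / 2) (\<eta> powr (1 / (1 - \<alpha>)))"
  have s: "0 < s" "s < 1" using \<eta> by (auto simp: s_def)
  have "s powr (1 - \<alpha>) \<le> (\<eta> powr (1 / (1 - \<alpha>))) powr (1 - \<alpha>)"
    using s \<alpha> by (intro powr_mono2) (auto simp: s_def)
  also have "\<dots> = \<eta>" using \<eta> \<alpha> by (simp add: powr_powr)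
  finally have s\<eta>: "s powr (1 - \<alpha>) \<le> \<eta>" .
  define r where "r = 1 - s"
  have r: "0 < r" "r < 1" using s by (auto simp: r_def)
  define \<delta> where "\<delta> = \<eta> / (1 - \<alpha>)"
  define d where "d = 8 * \<delta> / (1 - \<rho>')\<^sup>2"
  have \<delta>: "0 < \<delta>" using \<eta> \<alpha> by (simp add: \<delta>_def)
  have Cd: "C * d = e" using C \<rho>' \<alpha> by (simp add: d_def \<delta>_def \<eta>_def)
  have d0: "0 \<le> d" using \<delta> by (simp add: d_def)
  have "(1 - \<rho>')\<^sup>2 \<le> 1" using \<rho>' by (intro power_le_one) auto
  then have "\<delta> * (1 - \<rho>')\<^sup>2 \<le> 8 * \<delta>" using \<delta> mult_left_mono[of "(1 - \<rho>')\<^sup>2" 1 \<delta>] by simp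
  then have \<delta>d: "\<delta> \<le> d" using \<rho>' by (simp add: d_def field_simps)
  have "zyg_norm \<beta> (wcomp u \<phi> (\<lambda>z. f z - f (of_real r * z))) \<le> 34 * M + e"
    if f: "f \<in> bloch_space \<alpha>" "bloch_norm \<alpha> f \<le> 1" for f
  proof -
    define g where "g = (\<lambda>z. f z - f (of_real r * z))"
    have holf: "f holomorphic_on udisk" using f by (simp add: bloch_space_def)
    have holr: "(\<lambda>z. f (of_real r * z)) holomorphic_on udisk"
      using holf r by (intro holomorphic_dilation) auto
    have holg: "g holomorphic_on udisk"
      unfolding g_def using holf holr by (intro holomorphic_intros)
    have g\<delta>: "cmod (g z) \<le> \<delta>" if "z \<in> udisk" for z
    proof -
      have "cmod (g z) \<le> (1 - r) powr (1 - \<alpha>) / (1 - \<alpha>)"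
        unfolding g_def using r that by (intro norm_diff_dilation_le[OF \<alpha> f]) auto
      also have "\<dots> \<le> \<delta>"
        unfolding \<delta>_def using s\<eta> \<alpha> by (intro divide_right_mono) (auto simp: r_def)
      finally show ?thesis .
    qed
    have g1: "cmod (deriv g z) \<le> 2 * weight (- \<alpha>) z" if z: "z \<in> udisk" for z
    proof -
      have "deriv g z = deriv f z - deriv (\<lambda>z. f (of_real r * z)) z"
        using deriv_lincomb[OF holf holr z, of 1 "-1"] by (simp add: g_def)
      then have "weight \<alpha> z * cmod (deriv g z)
          \<le> weight \<alpha> z * (cmod (deriv f z) + cmod (deriv (\<lambda>z. f (of_real r * z)) z))"
        by (intro mult_left_mono) (simp_all add: norm_triangle_ineq4)
      also have "\<dots> \<le> 2"
        using bloch_norm_ge[OF f(1) z] dilation_deriv_le[OF f(1) _ _ _ z, of r] f(2) \<alpha> r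
        by (simp add: distrib_left)
      finally show ?thesis
        using weight_pos[OF z, of \<alpha>] by (simp add: powr_minus field_simps)
    qed
    \<comment> \<open>The factor 2 in \<open>g1\<close>, from f and its dilation, times the 16 of
      \<open>deriv_growth\<close>.\<close>
    have g2: "cmod (deriv (deriv g) z) \<le> 32 * weight (- (\<alpha> + 1)) z" if z: "z \<in> udisk" for z
    proof -
      have "cmod (deriv (deriv g) z) \<le> 16 * 2 * weight (- (\<alpha> + 1)) z"
        by (rule deriv_growth) (use holg g1 \<alpha> z in \<open>auto intro!: holomorphic_deriv\<close>)
      then show ?thesis by simp
    qed
    have loc: "cmod (deriv g z) \<le> d" "cmod (deriv (deriv g) z) \<le> d" if "cmod z \<le> \<rho>'" for z
      unfolding d_def using that \<rho>'
      by (intro bounded_deriv_le[OF holg g\<delta>] bounded_deriv2_le[OF holg g\<delta>]; simp)+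
    have in\<phi>: "\<phi> z \<in> udisk" if "z \<in> udisk" for z using self_maps_in_udisk[OF \<phi> that] .
    have "zyg_norm \<beta> (wcomp u \<phi> g)
      \<le> (cmod (u 0) + cmod (deriv u 0) + cmod (u 0) * cmod (deriv \<phi> 0)) * d + (3 * b * d + 34 * M)"
    proof (rule zyg_norm_wcomp_le[OF u \<phi> holg])
      show "cmod (g (\<phi> 0)) \<le> d" using g\<delta>[OF in\<phi>[of 0]] \<delta>d by simp
      show "cmod (deriv g (\<phi> 0)) \<le> d" by (rule loc(1)[OF \<rho>'(4)])
      fix z :: complex assume z: "z \<in> udisk"
      let ?U = "weight \<beta> z * cmod (deriv (deriv u) z)"
        and ?A = "weight \<beta> z * cmod (2 * deriv u z * deriv \<phi> z + u z * deriv (deriv \<phi>) z)"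
        and ?B = "weight \<beta> z * cmod (u z * (deriv \<phi> z)\<^sup>2)"
      \<comment> \<open>This holds for every z, without the case distinction, because g itself is
        small on the whole disc.\<close>
      have 0: "?U * cmod (g (\<phi> z)) \<le> b * d"
        using b(1) b(2)[OF z] g\<delta>[OF in\<phi>[OF z]] \<delta>d by (intro mult_mono) auto
      show "?U * cmod (g (\<phi> z)) + ?A * cmod (deriv g (\<phi> z)) + ?B * cmod (deriv (deriv g) (\<phi> z))
          \<le> 3 * b * d + 34 * M"
      proof (cases "cmod (\<phi> z) \<le> \<rho>'")
        case True
        have "?A * cmod (deriv g (\<phi> z)) \<le> b * d" "?B * cmod (deriv (deriv g) (\<phi> z)) \<le> b * d"
          using b(1) b(3,4)[OF z] loc[OF True] by (auto intro!: mult_mono)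
        with 0 M show ?thesis by linarith
      next
        case False
        then have big: "\<rho> \<le> cmod (\<phi> z)" using \<rho>' by simp
        have w: "0 < weight a (\<phi> z)" for a by (rule weight_pos[OF in\<phi>[OF z]])
        have "?A * cmod (deriv g (\<phi> z)) \<le> (M * weight \<alpha> (\<phi> z)) * (2 * weight (- \<alpha>) (\<phi> z))"
          by (rule mult_mono[OF A[OF z big] g1[OF in\<phi>[OF z]]]) (use M in auto)
        also have "\<dots> = 2 * M"
          using w[of \<alpha>] by (simp add: powr_minus)
        finally have 1: "?A * cmod (deriv g (\<phi> z)) \<le> 2 * M" .
        have "?B * cmod (deriv (deriv g) (\<phi> z))
            \<le> (M * weight (\<alpha> + 1) (\<phi> z)) * (32 * weight (- (\<alpha> + 1)) (\<phi> z))"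
          by (rule mult_mono[OF B[OF z big] g2[OF in\<phi>[OF z]]]) (use M in auto)
        also have "\<dots> = 32 * M * (weight (\<alpha> + 1) (\<phi> z) * weight (- (\<alpha> + 1)) (\<phi> z))"
          by (simp only: mult_ac)
        also have "\<dots> = 32 * M"
          using w[of "\<alpha> + 1"] by (simp only: powr_minus) simp
        finally have 2: "?B * cmod (deriv (deriv g) (\<phi> z)) \<le> 32 * M" .
        have "0 \<le> b * d" using b(1) d0 by simp
        with 0 1 2 show ?thesis by linarith
      qed
    qed
    also have "\<dots> = C * d + 34 * M" by (simp add: C_def algebra_simps)
    finally show ?thesis using Cd by (simp add: g_def)
  qed
  with r show thesis by (rule that)
qed

section \<open>Comparison of the essential norm with the two upper limits\<close>

theorem theorem4p3:
  fixes \<alpha> \<beta> :: real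
  assumes "0 < \<alpha>" and "\<alpha> < 1" and "0 < \<beta>"
  shows "\<exists>C>0. \<forall>u \<phi>. u holomorphic_on udisk \<longrightarrow> \<phi> \<in> self_maps \<longrightarrow>
     bdd_wop (bloch_space \<alpha>) (bloch_norm \<alpha>) (zyg_space \<beta>) (zyg_norm \<beta>) (wcomp u \<phi>) \<longrightarrow>
     (let E = ereal (ess_norm (bloch_space \<alpha>) (bloch_norm \<alpha>) (zyg_space \<beta>) (zyg_norm \<beta>) (wcomp u \<phi>));
          M = max (limsup (\<lambda>n. ereal ((real n + 1) powr \<alpha>) *
                      nu_norm \<beta> (\<lambda>z. (2 * deriv u z * deriv \<phi> z + u z * deriv (deriv \<phi>) z) * \<phi> z ^ n)))
                  (limsup (\<lambda>n. ereal ((real n + 1) powr (\<alpha> + 1)) *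
                      nu_norm \<beta> (\<lambda>z. u z * (deriv \<phi> z)\<^sup>2 * \<phi> z ^ n)))
      in M / ereal C \<le> E \<and> E \<le> ereal C * M)"
\<comment> \<open>The upper estimate dictates 408 = 34 * 12; the lower one needs only 132.\<close>
proof (intro exI[of _ 408] conjI allI impI)
  note \<alpha> = assms(1,2)
  fix u \<phi>
  assume u: "u holomorphic_on udisk" and \<phi>: "\<phi> \<in> self_maps"
    and T: "bdd_wop (bloch_space \<alpha>) (bloch_norm \<alpha>) (zyg_space \<beta>) (zyg_norm \<beta>) (wcomp u \<phi>)"
  define A where "A = (\<lambda>z. 2 * deriv u z * deriv \<phi> z + u z * deriv (deriv \<phi>) z)"
  define B where "B = (\<lambda>z. u z * (deriv \<phi> z)\<^sup>2)"
  define SA where "SA = (\<lambda>n. ereal ((real n + 1) powr \<alpha>) * nu_norm \<beta> (\<lambda>z. A z * \<phi> z ^ n))"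
  define SB where "SB = (\<lambda>n. ereal ((real n + 1) powr (\<alpha> + 1)) * nu_norm \<beta> (\<lambda>z. B z * \<phi> z ^ n))"
  define M where "M = max (limsup SA) (limsup SB)"
  define \<K> where "\<K> = {K. cpt_wop (bloch_space \<alpha>) (bloch_norm \<alpha>) (zyg_space \<beta>) (zyg_norm \<beta>) K}"
  define L where
    "L = (\<lambda>K. wop_norm (bloch_space \<alpha>) (bloch_norm \<alpha>) (zyg_norm \<beta>) (\<lambda>f z. wcomp u \<phi> f z - K f z))"
  define E where "E = ess_norm (bloch_space \<alpha>) (bloch_norm \<alpha>) (zyg_space \<beta>) (zyg_norm \<beta>) (wcomp u \<phi>)"
  have E: "E = Inf (L ` \<K>)" by (simp add: E_def ess_norm_def L_def \<K>_def)
  have maps: "wcomp u \<phi> f \<in> zyg_space \<beta>" if "f \<in> bloch_space \<alpha>" for f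
    using T that by (auto simp: bdd_wop_def linear_op_on_def)
  have in\<phi>: "cmod (\<phi> z) < 1" if "z \<in> udisk" for z
    using self_maps_in_udisk[OF \<phi> that] by simp
  have dil: "(\<lambda>f. wcomp u \<phi> (\<lambda>z. f (of_real r * z))) \<in> \<K>" if "0 < r" "r < 1" for r
    unfolding \<K>_def using cpt_wop_wcomp_dilation[OF \<alpha> u \<phi> maps that] by simp
  then have \<K>: "\<K> \<noteq> {}" by (metis empty_iff dense zero_less_one)

  \<comment> \<open>Nonnegativity of \<open>M\<close> excludes the value minus infinity and later
    allows 132 to be weakened to 408.\<close>
  have "ereal 0 \<le> nu_norm \<beta> g" for g
    unfolding nu_norm_def by (rule SUP_upper2[of 0]) auto
  then have "0 \<le> SA n" "0 \<le> SB n" for n by (auto simp: SA_def SB_def zero_ereal_def[symmetric])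
  then have "0 \<le> limsup SB" by (intro le_Limsup) auto
  then have M0: "0 \<le> M" by (simp add: M_def le_max_iff_disj)
  have lower: "M \<le> ereal (132 * L K)" if K: "K \<in> \<K>" for K
  proof (rule ereal_le_epsilon2)
    fix e :: real assume e: "0 < e"
    have "\<forall>\<^sub>F n in sequentially. \<forall>z\<in>udisk. real n powr (\<alpha> - 1) * (weight \<beta> z *
      cmod (of_nat n * A z * \<phi> z ^ (n - 1) + of_nat n * of_nat (n - 1) * B z * \<phi> z ^ (n - 2)))
      \<le> 4 * L K + e / 33"
      unfolding A_def B_def L_def
      by (rule eventually_monomial_bound[OF \<alpha> u \<phi> T]) (use K e in \<open>simp_all add: \<K>_def\<close>)
    then obtain N where N: "\<And>n z. N \<le> n \<Longrightarrow> z \<in> udisk \<Longrightarrow> real n powr (\<alpha> - 1) * (weight \<beta> z *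
      cmod (of_nat n * A z * \<phi> z ^ (n - 1) + of_nat n * of_nat (n - 1) * B z * \<phi> z ^ (n - 2)))
      \<le> 4 * L K + e / 33"
      unfolding eventually_sequentially by blast
    \<comment> \<open>With this value 33 * m = 132 * L K + e.\<close>
    define m where "m = 4 * L K + e / 33"
    \<comment> \<open>\<open>Suc N\<close> is used because \<open>separate_coefficients\<close> asks
      for a positive threshold.\<close>
    have sep: "2 * Suc N \<le> n \<Longrightarrow> (real n + 1) powr (\<alpha> + 1) * (weight \<beta> z * cmod (B z * \<phi> z ^ n)) \<le> 8 * m"
      "2 * Suc N + 1 \<le> n \<Longrightarrow> (real n + 1) powr \<alpha> * (weight \<beta> z * cmod (A z * \<phi> z ^ n)) \<le> 33 * m"
      if z: "z \<in> udisk" for n z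
    proof -
      have D: "real n powr (\<alpha> - 1) * (weight \<beta> z *
          cmod (of_nat n * A z * \<phi> z ^ (n - 1) + of_nat n * of_nat (n - 1) * B z * \<phi> z ^ (n - 2))) \<le> m"
        if "Suc N \<le> n" for n
        unfolding m_def by (rule N[OF _ z]) (use that in simp)
      note sc = separate_coefficients[OF \<alpha> less_imp_le[OF in\<phi>[OF z]] powr_ge_zero zero_less_Suc D]
      show "2 * Suc N \<le> n \<Longrightarrow> (real n + 1) powr (\<alpha> + 1) * (weight \<beta> z * cmod (B z * \<phi> z ^ n)) \<le> 8 * m"
        by (rule sc(1))
      show "2 * Suc N + 1 \<le> n \<Longrightarrow> (real n + 1) powr \<alpha> * (weight \<beta> z * cmod (A z * \<phi> z ^ n)) \<le> 33 * m"
        by (rule sc(2))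
    qed
    show "M \<le> ereal (132 * L K) + ereal e"
    proof -
      have "0 \<le> (real (2 * Suc N) + 1) powr (\<alpha> + 1) * (weight \<beta> 0 * cmod (B 0 * \<phi> 0 ^ (2 * Suc N)))"
        by simp
      also have "\<dots> \<le> 8 * m" by (rule sep) auto
      finally have m: "0 \<le> m" by simp
      have "SA n \<le> ereal (33 * m)" "SB n \<le> ereal (33 * m)" if n: "2 * Suc N + 1 \<le> n" for n
      proof -
        show "SA n \<le> ereal (33 * m)"
          unfolding SA_def using sep(2)[OF _ n] by (subst nu_norm_le_iff) auto
        have "(real n + 1) powr (\<alpha> + 1) * (weight \<beta> z * cmod (B z * \<phi> z ^ n)) \<le> 33 * m"
          if "z \<in> udisk" for z
          using sep(1)[OF that, of n] n m by linarith
        then show "SB n \<le> ereal (33 * m)"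
          unfolding SB_def by (subst nu_norm_le_iff) auto
      qed
      then have "limsup SA \<le> ereal (33 * m)" "limsup SB \<le> ereal (33 * m)"
        by (auto intro!: Limsup_bounded eventually_sequentiallyI[of "2 * Suc N + 1"])
      then show ?thesis by (simp add: M_def m_def algebra_simps)
    qed
  qed
  \<comment> \<open>One compact operator suffices to show that the upper limits are finite, so that
    the remaining argument takes place in the reals.\<close>
  from \<K> lower obtain k where "M \<le> ereal k" by blast
  with M0 obtain m where m: "M = ereal m" "0 \<le> m" by (cases M) auto
  have mL: "m / 132 \<le> L K" if "K \<in> \<K>" for K
    using lower[OF that] by (simp add: m)
  then have "m / 132 \<le> E"
    unfolding E using \<K> by (intro cINF_greatest)
  with m(2) have low: "m / 408 \<le> E" by linarith

  have "E \<le> 408 * m + e" if e: "0 < e" for e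
  proof -
    \<comment> \<open>A slightly larger number makes the inequality strict, which turns upper limits
      into eventual bounds; 816 = 2 * 408 makes the excess e / 2.\<close>
    define m' where "m' = m + e / 816"
    have m': "0 \<le> m'" using m(2) e by (simp add: m'_def)
    have "M < ereal m'" using m(1) e by (simp add: m'_def)
    then have "limsup SA < ereal m'" "limsup SB < ereal m'"
      unfolding M_def by simp_all
    then have "\<forall>\<^sub>F n in sequentially. SA n < ereal m' \<and> SB n < ereal m'"
      by (intro eventually_conj Limsup_lessD)
    then obtain N where N: "\<And>n. N \<le> n \<Longrightarrow> SA n < ereal m' \<and> SB n < ereal m'"
      unfolding eventually_sequentially by blast
    have bounds: "(real n + 1) powr \<alpha> * (weight \<beta> z * cmod (A z) * cmod (\<phi> z) ^ n) \<le> m'"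
      "(real n + 1) powr (\<alpha> + 1) * (weight \<beta> z * cmod (B z) * cmod (\<phi> z) ^ n) \<le> m'"
      if "N \<le> n" "z \<in> udisk" for n z
    proof -
      have le: "SA n \<le> ereal m'" "SB n \<le> ereal m'" using N[OF that(1)] by auto
      have "\<forall>z\<in>udisk. (real n + 1) powr \<alpha> * (weight \<beta> z * cmod (A z * \<phi> z ^ n)) \<le> m'"
        using le(1) unfolding SA_def by (subst (asm) nu_norm_le_iff) auto
      then show "(real n + 1) powr \<alpha> * (weight \<beta> z * cmod (A z) * cmod (\<phi> z) ^ n) \<le> m'"
        using that(2) by (auto simp: norm_mult norm_power mult.assoc)
      have "\<forall>z\<in>udisk. (real n + 1) powr (\<alpha> + 1) * (weight \<beta> z * cmod (B z * \<phi> z ^ n)) \<le> m'"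
        using le(2) unfolding SB_def by (subst (asm) nu_norm_le_iff) auto
      then show "(real n + 1) powr (\<alpha> + 1) * (weight \<beta> z * cmod (B z) * cmod (\<phi> z) ^ n) \<le> m'"
        using that(2) by (auto simp: norm_mult norm_power mult.assoc)
    qed
    define \<rho> where "\<rho> = 1 - 1 / (real N + 2)"
    have \<rho>: "\<rho> < 1" by (simp add: \<rho>_def)
    have wA: "weight \<beta> z * cmod (A z) \<le> (12 * m') * weight \<alpha> (\<phi> z)"
      and wB: "weight \<beta> z * cmod (B z) \<le> (12 * m') * weight (\<alpha> + 1) (\<phi> z)"
      if z: "z \<in> udisk" and big: "\<rho> \<le> cmod (\<phi> z)" for z
      using \<alpha> bounds[OF _ z] in\<phi>[OF z] big unfolding \<rho>_def
      by (intro le_powr_of_power_bounds[where N = N]; simp)+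
    obtain r where r: "0 < r" "r < 1" and le: "\<And>f. f \<in> bloch_space \<alpha> \<Longrightarrow> bloch_norm \<alpha> f \<le> 1 \<Longrightarrow>
        zyg_norm \<beta> (wcomp u \<phi> (\<lambda>z. f z - f (of_real r * z))) \<le> 34 * (12 * m') + e / 2"
    proof (rule wcomp_dilation_diff_bound[OF \<alpha> u \<phi> maps _ _ \<rho>, where e = "e / 2" and M = "12 * m'"])
      fix z :: complex assume z: "z \<in> udisk" "\<rho> \<le> cmod (\<phi> z)"
      show "weight \<beta> z * cmod (2 * deriv u z * deriv \<phi> z + u z * deriv (deriv \<phi>) z)
          \<le> 12 * m' * weight \<alpha> (\<phi> z)"
        using wA[OF z] by (simp add: A_def)
      show "weight \<beta> z * cmod (u z * (deriv \<phi> z)\<^sup>2) \<le> 12 * m' * weight (\<alpha> + 1) (\<phi> z)"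
        using wB[OF z] by (simp add: B_def)
    qed (use e m' that in auto)
    let ?K = "\<lambda>f. wcomp u \<phi> (\<lambda>z. f (of_real r * z))"
    \<comment> \<open>The lower estimate makes the infimum over compact operators a genuine lower
      bound.\<close>
    have "bdd_below (L ` \<K>)" using mL by (auto intro!: bdd_belowI[of _ "m / 132"])
    then have "E \<le> L ?K"
      unfolding E using dil[OF r] by (rule cINF_lower)
    also have "L ?K \<le> 34 * (12 * m') + e / 2"
      unfolding L_def wop_norm_def
    proof (rule cSUP_least)
      show "{f \<in> bloch_space \<alpha>. bloch_norm \<alpha> f \<le> 1} \<noteq> {}"
        using bloch_monomial_in_space[OF \<alpha>] bloch_norm_monomial_le_1[OF \<alpha>] by blast
      fix f assume "f \<in> {f \<in> bloch_space \<alpha>. bloch_norm \<alpha> f \<le> 1}"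
      then have "zyg_norm \<beta> (wcomp u \<phi> (\<lambda>z. f z - f (of_real r * z))) \<le> 34 * (12 * m') + e / 2"
        by (intro le) auto
      then show "zyg_norm \<beta> (\<lambda>z. wcomp u \<phi> f z - ?K f z) \<le> 34 * (12 * m') + e / 2"
        by (simp add: wcomp_def right_diff_distrib)
    qed
    also have "\<dots> = 408 * m + e" by (simp add: m'_def)
    finally show ?thesis .
  qed
  then have "E \<le> 408 * m" by (rule field_le_epsilon)
  with low m(1) have "M / ereal 408 \<le> ereal E \<and> ereal E \<le> ereal 408 * M" by simp
  then show "let E = ereal (ess_norm (bloch_space \<alpha>) (bloch_norm \<alpha>) (zyg_space \<beta>) (zyg_norm \<beta>) (wcomp u \<phi>));
          M = max (limsup (\<lambda>n. ereal ((real n + 1) powr \<alpha>) *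
                      nu_norm \<beta> (\<lambda>z. (2 * deriv u z * deriv \<phi> z + u z * deriv (deriv \<phi>) z) * \<phi> z ^ n)))
                  (limsup (\<lambda>n. ereal ((real n + 1) powr (\<alpha> + 1)) *
                      nu_norm \<beta> (\<lambda>z. u z * (deriv \<phi> z)\<^sup>2 * \<phi> z ^ n)))
      in M / ereal 408 \<le> E \<and> E \<le> ereal 408 * M"
    unfolding Let_def M_def SA_def SB_def A_def B_def E_def .
qed simp

end
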